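(* There is an absolute constant $C>0$ such that the following holds. Let $K$ be a real number and let $\mathcal{A}\subset\{0,1\}^n$ be nonempty with $|\mathcal{A}|\le\frac78 2^n$ and $$|\partial_e(\mathcal{A})|\le|\mathcal{A}|\Big(\log_2\big(2^n/|\mathcal{A}|\big)+K\Big).$$ Then $$\max_{i\in[n]}I_i(\mathbf{1}_{\mathcal{A}})\ge 2^{-C(K+1)^2}\frac{|\mathcal{A}|}{2^n}.$$
   Context: $Q_n$ is the graph on $\{0,1\}^n$ with edges between vertices differing in exactly one coordinate; $\partial_e(\mathcal{A})$ is the set of edges of $Q_n$ with exactly one endpoint in $\mathcal{A}$. $\mathbf{1}_{\mathcal{A}}$ is the indicator function of $\mathcal{A}$. For $f:\{0,1\}^n\to\{0,1\}$ and $i\in[n]$, the influence in direction $i$ is $I_i(f)=|\{x\in\{0,1\}^n: f(x)\ne f(x\oplus e_i)\}|/2^n$, where $x\oplus e_i$ is $x$ with its $i$th coordinate changed. *)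

theory Defs
  imports Complex_Main "HOL-Library.FuncSet" "HOL-Library.Indicator_Function"
begin

text \<open>The dimension is a natural number rather than an index type, so that it can be quantified over
  inside a formula. Vectors are extensional functions, which makes equality of vectors and the
  cardinality of sets of vectors the intended ones.\<close>

definition cube :: "nat \<Rightarrow> (nat \<Rightarrow> nat) set" where
  "cube n = {1..n} \<rightarrow>\<^sub>E {0, 1}"

definition cube_edges :: "nat \<Rightarrow> (nat \<Rightarrow> nat) set set" where
  "cube_edges n =
    {{x, y} | x y. x \<in> cube n \<and> y \<in> cube n \<and> card {i \<in> {1..n}. x i \<noteq> y i} = 1}"

definition edge_boundary :: "nat \<Rightarrow> (nat \<Rightarrow> nat) set \<Rightarrow> (nat \<Rightarrow> nat) set set" where
  "edge_boundary n A = {e \<in> cube_edges n. card (e \<inter> A) = 1}"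

definition flip :: "(nat \<Rightarrow> nat) \<Rightarrow> nat \<Rightarrow> nat \<Rightarrow> nat" where
  "flip x i = x(i := 1 - x i)"

definition influence :: "nat \<Rightarrow> ((nat \<Rightarrow> nat) \<Rightarrow> nat) \<Rightarrow> nat \<Rightarrow> real" where
  "influence n f i = real (card {x \<in> cube n. f x \<noteq> f (flip x i)}) / 2 ^ n"

end

theory Submission
  imports Defs "HOL-Analysis.Harmonic_Numbers"
begin

text \<open>
  Let \<open>f\<close> be the density of the uniform distribution on \<open>A\<close>, let \<open>f_S\<close> be its marginal on the coordinates
  in \<open>S\<close>, and let \<open>h_i = E |f - f \<circ> flip_i| / 2\<close>, so that the sum of the \<open>h_i\<close> is \<open>|\<partial>A| / |A|\<close>.
  Adding \<open>i\<close> to \<open>S\<close> increases the entropy (in bits) of \<open>f_S\<close> by at most \<open>h_i\<close>, and the hypothesis says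
  that the total loss in these inequalities is at most \<open>K\<close>. Hence a set \<open>S\<close> that is maximal subject to
  the loss being at least a constant fraction of \<open>h(S)\<close> has \<open>h(S) = O(K + 1)\<close>, and every further
  coordinate is lossless up to a constant factor; such a coordinate is, given the coordinates in \<open>S\<close>,
  either nearly unbiased or nearly determined. If \<open>f_S\<close> were close to 1, then revealing one of the
  nearly determined coordinates would move it away from 1. Building the distance of \<open>f_S\<close> from 1 into
  the quantity that is maximised therefore yields \<open>S\<close> with \<open>h(S) = O(K + 1)\<close> and with \<open>f_S\<close> at
  constant distance from 1.

  The Falik-Samorodnitsky argument (the logarithmic Sobolev inequality applied to the martingale
  differences) for \<open>sqrt (1 + f_S)\<close>, whose variance is bounded below and whose energy is \<open>O(h(S))\<close>, then
  gives some \<open>h_i\<close> that is at least \<open>exp (- O(K + 1))\<close>.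
\<close>

section \<open>Means and marginals on the cube\<close>

definition mean :: "nat \<Rightarrow> ((nat \<Rightarrow> nat) \<Rightarrow> real) \<Rightarrow> real" where
  "mean n F = (\<Sum>x\<in>cube n. F x) / 2 ^ n"

text \<open>The conditional expectation given the coordinates in \<open>S\<close>, kept as a
  function on the whole cube that ignores the other coordinates. If \<open>F\<close> is a density,
  it is the density of the marginal on \<open>S\<close>, and all marginals can be compared under the
  same \<open>mean\<close>.\<close>

definition cond_mean :: "nat \<Rightarrow> nat set \<Rightarrow> ((nat \<Rightarrow> nat) \<Rightarrow> real) \<Rightarrow> (nat \<Rightarrow> nat) \<Rightarrow> real" where
  "cond_mean n S F x = mean n (\<lambda>y. F (\<lambda>j. if j \<in> S then x j else y j))"

lemma finite_cube [simp]: "finite (cube n)"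
  unfolding cube_def by (rule finite_PiE) auto

lemma card_cube: "card (cube n) = 2 ^ n"
  unfolding cube_def by (subst card_PiE) (auto simp: card_insert_if numeral_2_eq_2)

lemma flip_in_cube [simp]: "x \<in> cube n \<Longrightarrow> i \<in> {1..n} \<Longrightarrow> flip x i \<in> cube n"
  unfolding cube_def flip_def by (auto simp: PiE_iff extensional_def)

lemma cube_value: "x \<in> cube n \<Longrightarrow> i \<in> {1..n} \<Longrightarrow> x i = 0 \<or> x i = 1"
  unfolding cube_def by (auto simp: PiE_iff)

lemma flip_flip [simp]: "x \<in> cube n \<Longrightarrow> i \<in> {1..n} \<Longrightarrow> flip (flip x i) i = x"
  using cube_value[of x n i] unfolding flip_def by (auto simp: fun_eq_iff)

lemma flip_commute: "flip (flip x i) j = flip (flip x j) i"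
  unfolding flip_def by (auto simp: fun_eq_iff)

lemma mean_cong: "(\<And>x. x \<in> cube n \<Longrightarrow> F x = G x) \<Longrightarrow> mean n F = mean n G"
  unfolding mean_def by (simp cong: sum.cong)

lemma mean_mono: "(\<And>x. x \<in> cube n \<Longrightarrow> F x \<le> G x) \<Longrightarrow> mean n F \<le> mean n G"
  unfolding mean_def by (intro divide_right_mono sum_mono) auto

lemma mean_nonneg: "(\<And>x. x \<in> cube n \<Longrightarrow> 0 \<le> F x) \<Longrightarrow> 0 \<le> mean n F"
  unfolding mean_def by (intro divide_nonneg_nonneg sum_nonneg) auto

lemma mean_add: "mean n (\<lambda>x. F x + G x) = mean n F + mean n G"
  unfolding mean_def by (simp add: sum.distrib add_divide_distrib)

lemma mean_diff: "mean n (\<lambda>x. F x - G x) = mean n F - mean n G"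
  unfolding mean_def by (simp add: sum_subtractf diff_divide_distrib)

lemma mean_cmult: "mean n (\<lambda>x. c * F x) = c * mean n F"
  unfolding mean_def by (simp add: sum_distrib_left)

lemma mean_divide: "mean n (\<lambda>x. F x / c) = mean n F / c"
  unfolding mean_def by (simp add: sum_divide_distrib mult.commute)

lemma mean_const [simp]: "mean n (\<lambda>x. c) = c"
  unfolding mean_def by (simp add: card_cube)

lemma mean_sum: "mean n (\<lambda>x. \<Sum>i\<in>I. F i x) = (\<Sum>i\<in>I. mean n (F i))"
  unfolding mean_def by (subst sum.swap) (simp add: sum_divide_distrib)

lemma mean_square_le: "(mean n F)\<^sup>2 \<le> mean n (\<lambda>x. (F x)\<^sup>2)"
proof -
  have "0 \<le> mean n (\<lambda>x. (F x - mean n F)\<^sup>2)" by (rule mean_nonneg) auto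
  also have "\<dots> = mean n (\<lambda>x. (F x)\<^sup>2 - 2 * mean n F * F x + (mean n F)\<^sup>2)"
    by (rule mean_cong) (simp add: power2_eq_square algebra_simps)
  also have "\<dots> = mean n (\<lambda>x. (F x)\<^sup>2) - (mean n F)\<^sup>2"
    by (simp only: mean_add mean_diff mean_cmult mean_const) (simp add: power2_eq_square)
  finally show ?thesis by simp
qed

lemma mean_flip:
  assumes "i \<in> {1..n}"
  shows "mean n (\<lambda>x. F (flip x i)) = mean n F"
proof -
  have "bij_betw (\<lambda>x. flip x i) (cube n) (cube n)"
    by (rule bij_betw_byWitness[where f' = "\<lambda>x. flip x i"]) (use assms in auto)
  from sum.reindex_bij_betw[OF this, of F] show ?thesis unfolding mean_def by simp
qed

lemma mean_pair:
  assumes "i \<in> {1..n}"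
  shows "mean n F = mean n (\<lambda>x. (F x + F (flip x i)) / 2)"
  using mean_flip[OF assms, of F] by (simp add: mean_divide mean_add)

section \<open>Marginals as successive averages over single coordinates\<close>

lemma merge_in_cube:
  "x \<in> cube n \<Longrightarrow> y \<in> cube n \<Longrightarrow> (\<lambda>j. if j \<in> S then x j else y j) \<in> cube n"
  unfolding cube_def by (auto simp: PiE_iff extensional_def)

lemma cond_mean_empty [simp]: "cond_mean n {} F x = mean n F"
  unfolding cond_mean_def by simp

lemma cond_mean_full [simp]:
  assumes "x \<in> cube n"
  shows "cond_mean n {1..n} F x = F x"
proof -
  have "(\<lambda>j. if j \<in> {1..n} then x j else y j) = x" if "y \<in> cube n" for y
    using assms that unfolding cube_def by (auto simp: fun_eq_iff PiE_iff extensional_def)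
  then have "cond_mean n {1..n} F x = mean n (\<lambda>y. F x)"
    unfolding cond_mean_def by (intro mean_cong) metis
  then show ?thesis by simp
qed

lemma cond_mean_full_Suc [simp]: "x \<in> cube n \<Longrightarrow> cond_mean n {Suc 0..n} F x = F x"
  using cond_mean_full by simp

lemma cond_mean_flip: "i \<notin> S \<Longrightarrow> cond_mean n S F (flip x i) = cond_mean n S F x"
  unfolding cond_mean_def flip_def
  by (rule mean_cong) (auto intro!: arg_cong[where f = F] simp: fun_eq_iff)

text \<open>Pair the resampled point \<open>y\<close> with \<open>flip y i\<close>: one of the two
  agrees with \<open>x\<close> at \<open>i\<close>, the other with \<open>flip x i\<close>.\<close>

lemma cond_mean_insert:
  assumes x: "x \<in> cube n" and i: "i \<in> {1..n}" "i \<notin> S"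
  shows "cond_mean n S F x =
    (cond_mean n (insert i S) F x + cond_mean n (insert i S) F (flip x i)) / 2"
proof -
  let ?m = "\<lambda>T x y j. if j \<in> T then x j else (y j :: nat)"
  have pt: "F (?m S x y) + F (?m S x (flip y i))
      = F (?m (insert i S) x y) + F (?m (insert i S) (flip x i) y)" if "y \<in> cube n" for y
  proof (cases "x i = y i")
    case True
    then have "?m S x y = ?m (insert i S) x y"
      "?m S x (flip y i) = ?m (insert i S) (flip x i) y"
      using i by (auto simp: fun_eq_iff flip_def)
    then show ?thesis by (simp only:)
  next
    case False
    then have "x i = 0 \<and> y i = 1 \<or> x i = 1 \<and> y i = 0"
      using cube_value[OF x i(1)] cube_value[OF that i(1)] by auto
    then have "?m S x y = ?m (insert i S) (flip x i) y"
      "?m S x (flip y i) = ?m (insert i S) x y"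
      using i by (auto simp: fun_eq_iff flip_def)
    then show ?thesis by (simp only: add.commute)
  qed
  have "cond_mean n S F x = mean n (\<lambda>y. (F (?m S x y) + F (?m S x (flip y i))) / 2)"
    unfolding cond_mean_def by (rule mean_pair[OF i(1)])
  also have "\<dots> = mean n (\<lambda>y. (F (?m (insert i S) x y) + F (?m (insert i S) (flip x i) y)) / 2)"
    by (rule mean_cong) (simp only: pt)
  finally show ?thesis
    unfolding cond_mean_def by (simp only: mean_divide mean_add)
qed

lemma cond_mean_nonneg:
  "x \<in> cube n \<Longrightarrow> (\<And>y. y \<in> cube n \<Longrightarrow> 0 \<le> F y) \<Longrightarrow> 0 \<le> cond_mean n S F x"
  unfolding cond_mean_def by (intro mean_nonneg) (blast intro: merge_in_cube)

lemma cond_mean_pos: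
  assumes "x \<in> cube n" "\<And>y. y \<in> cube n \<Longrightarrow> 0 \<le> F y" "0 < F x"
  shows "0 < cond_mean n S F x"
  unfolding cond_mean_def mean_def
  using assms by (intro divide_pos_pos sum_pos2[of _ x]) (auto intro: merge_in_cube)

text \<open>Induction downwards from the full set, where \<open>cond_mean\<close> is
  \<open>F\<close> itself; each step averages out one more coordinate.\<close>

lemma subset_insert_induct [consumes 1, case_names full step]:
  assumes "S \<subseteq> {1..n::nat}" and "P {1..n}"
    and "\<And>S i. S \<subseteq> {1..n} \<Longrightarrow> i \<in> {1..n} \<Longrightarrow> i \<notin> S \<Longrightarrow> P (insert i S) \<Longrightarrow> P S"
  shows "P S"
  using assms(1)
proof (induct "card ({1..n} - S)" arbitrary: S)
  case 0
  then have "S = {1..n}" by auto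
  then show ?case using assms(2) by simp
next
  case (Suc k)
  then obtain i where i: "i \<in> {1..n} - S" by (metis card.empty ex_in_conv nat.distinct(1))
  have "k = card ({1..n} - insert i S)"
    using Suc.hyps(2) i by (metis Diff_insert card_Diff_singleton diff_Suc_1)
  then have "P (insert i S)" using Suc.prems i by (intro Suc.hyps(1)) auto
  then show ?case using Suc.prems i by (intro assms(3)[of S i]) auto
qed

text \<open>The tower property: averaging out a coordinate outside \<open>S\<close> only mixes
  points on which \<open>w\<close> is constant.\<close>

lemma mean_cond_mean_mult:
  assumes S: "S \<subseteq> {1..n}"
    and w: "\<And>x i. x \<in> cube n \<Longrightarrow> i \<in> {1..n} \<Longrightarrow> i \<notin> S \<Longrightarrow> w (flip x i) = w x"
  shows "mean n (\<lambda>x. w x * cond_mean n S F x) = mean n (\<lambda>x. w x * F x)"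
proof -
  have "\<forall>w. (\<forall>x i. x \<in> cube n \<longrightarrow> i \<in> {1..n} \<longrightarrow> i \<notin> S \<longrightarrow> w (flip x i) = w x) \<longrightarrow>
    mean n (\<lambda>x. w x * cond_mean n S F x) = mean n (\<lambda>x. w x * F x)"
    using S
  proof (induction rule: subset_insert_induct)
    case full
    then show ?case by (auto intro!: mean_cong simp: cond_mean_full)
  next
    case (step S i)
    show ?case
    proof (intro allI impI)
      fix w :: "(nat \<Rightarrow> nat) \<Rightarrow> real"
      assume w: "\<forall>x i. x \<in> cube n \<longrightarrow> i \<in> {1..n} \<longrightarrow> i \<notin> S \<longrightarrow> w (flip x i) = w x"
      have "mean n (\<lambda>x. w x * F x) = mean n (\<lambda>x. w x * cond_mean n (insert i S) F x)"
        using step.IH w by (intro step.IH[rule_format, symmetric]) blast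
      also have "\<dots> = mean n (\<lambda>x. w x * cond_mean n S F x)"
      proof (subst mean_pair[OF step.hyps(2)], intro mean_cong)
        fix x assume x: "x \<in> cube n"
        have "w (flip x i) = w x" using w x step.hyps by blast
        then show "(w x * cond_mean n (insert i S) F x
            + w (flip x i) * cond_mean n (insert i S) F (flip x i)) / 2 = w x * cond_mean n S F x"
          using cond_mean_insert[OF x step.hyps(2,3), of F] by (simp add: field_simps)
      qed
      finally show "mean n (\<lambda>x. w x * cond_mean n S F x) = mean n (\<lambda>x. w x * F x)" by simp
    qed
  qed
  then show ?thesis using w by blast
qed

lemma mean_cond_mean: "S \<subseteq> {1..n} \<Longrightarrow> mean n (cond_mean n S F) = mean n F"
  using mean_cond_mean_mult[of S n "\<lambda>_. 1" F] by simp

text \<open>Jensen's inequality, one coordinate at a time: averaging out \<open>j\<close> replaces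
  the pair of values across direction \<open>i\<close> by the midpoint of two such pairs. It is used
  for the L1 difference and for the Hellinger energy.\<close>

lemma cond_mean_contraction:
  assumes S: "S \<subseteq> {1..n}" and i: "i \<in> S"
    and F: "\<And>x. x \<in> cube n \<Longrightarrow> 0 \<le> F x"
    and convex: "\<And>a a' b b'. \<lbrakk>0 \<le> a; 0 \<le> a'; 0 \<le> b; 0 \<le> b'\<rbrakk> \<Longrightarrow>
      \<Theta> ((a + a') / 2) ((b + b') / 2) \<le> (\<Theta> a b + \<Theta> a' b') / (2::real)"
  shows "mean n (\<lambda>x. \<Theta> (cond_mean n S F x) (cond_mean n S F (flip x i)))
    \<le> mean n (\<lambda>x. \<Theta> (F x) (F (flip x i)))"
  using S i
proof (induction rule: subset_insert_induct)
  case full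
  then show ?case by (intro eq_refl mean_cong) (simp add: cond_mean_full)
next
  case (step S j)
  let ?g = "cond_mean n (insert j S) F"
  have i: "i \<in> {1..n}" using step by auto
  have "mean n (\<lambda>x. \<Theta> (cond_mean n S F x) (cond_mean n S F (flip x i)))
    \<le> mean n (\<lambda>x. (\<Theta> (?g x) (?g (flip x i)) + \<Theta> (?g (flip x j)) (?g (flip (flip x j) i))) / 2)"
  proof (rule mean_mono)
    fix x assume x: "x \<in> cube n"
    have *: "cond_mean n S F x = (?g x + ?g (flip x j)) / 2"
      "cond_mean n S F (flip x i) = (?g (flip x i) + ?g (flip (flip x j) i)) / 2"
      using cond_mean_insert[OF x step.hyps(2,3), of F]
        cond_mean_insert[OF flip_in_cube[OF x i] step.hyps(2,3), of F]
      by (simp_all only: flip_commute[of x i j])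
    show "\<Theta> (cond_mean n S F x) (cond_mean n S F (flip x i)) \<le>
      (\<Theta> (?g x) (?g (flip x i)) + \<Theta> (?g (flip x j)) (?g (flip (flip x j) i))) / 2"
      unfolding * by (intro convex cond_mean_nonneg F flip_in_cube x i step.hyps(2))
  qed
  also have "\<dots> = mean n (\<lambda>x. \<Theta> (?g x) (?g (flip x i)))"
    using mean_pair[OF step.hyps(2), of "\<lambda>x. \<Theta> (?g x) (?g (flip x i))"] by simp
  also have "\<dots> \<le> mean n (\<lambda>x. \<Theta> (F x) (F (flip x i)))"
    using step by simp
  finally show ?case .
qed

section \<open>Entropy\<close>

text \<open>The entropy functional of a function taking the values \<open>a\<close> and
  \<open>b\<close> with probability 1/2 each. The product form gives 0 ln 0 = 0.\<close>

definition ent2 :: "real \<Rightarrow> real \<Rightarrow> real" where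
  "ent2 a b = (a * ln a + b * ln b) / 2 - (a + b) / 2 * ln ((a + b) / 2)"

lemma ent2_zero [simp]: "ent2 0 0 = 0"
  unfolding ent2_def by simp

lemma ent2_commute: "ent2 a b = ent2 b a"
  unfolding ent2_def by (simp add: add.commute)

lemma mult_ln_div:
  assumes "0 \<le> a" "0 < m"
  shows "a * ln (a / m) = a * ln a - a * ln (m :: real)"
  using assms by (cases "a = 0") (auto simp: ln_div algebra_simps)

lemma ent2_eq:
  assumes "0 \<le> a" "0 \<le> b" "0 < a + b"
  shows "ent2 a b = (a * ln (a / ((a + b) / 2)) + b * ln (b / ((a + b) / 2))) / 2"
proof -
  define m where "m = (a + b) / 2"
  have "m > 0" and "m * ln m = (a * ln m + b * ln m) / 2"
    using assms by (auto simp: m_def algebra_simps add_divide_distrib)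
  then show ?thesis
    unfolding ent2_def m_def[symmetric] using assms by (simp add: mult_ln_div diff_divide_distrib add_divide_distrib)
qed

lemma mult_ln_div_le:
  assumes "0 \<le> a" "0 < m"
  shows "a * ln (a / m) \<le> a * (a / m - 1 :: real)"
  using assms by (cases "a = 0") (auto intro!: mult_left_mono ln_le_minus_one)

text \<open>For the larger value \<open>a\<close> the ratio of the mean to \<open>a\<close> lies in
  [1/2, 1], where \<open>ln\<close> is above its chord; the smaller value contributes a nonpositive
  term. Equality holds for a = b and for b = 0, the two lossless situations.\<close>

lemma ent2_le_ln2:
  assumes "0 \<le> a" "0 \<le> b"
  shows "ent2 a b \<le> ln 2 * (\<bar>a - b\<bar> / 2)"
  using assms
proof (induction a b rule: linorder_wlog)
  case (le b a)
  show ?case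
  proof (cases "a = 0")
    case True
    then show ?thesis using le by simp
  next
    case False
    then have a: "a > 0" using le by simp
    let ?m = "(a + b) / 2"
    have "(1 - (a - b) / a) * ln 1 + (a - b) / a * ln (1 / 2)
        \<le> ln ((1 - (a - b) / a) * 1 + (a - b) / a * (1 / 2))"
      using concave_onD[OF ln_concave, of "(a - b) / a" 1 "1 / 2"] a le by simp
    also have "(1 - (a - b) / a) * 1 + (a - b) / a * (1 / 2) = ?m / a"
      using a by (simp add: field_simps)
    also have "ln (?m / a) = - ln (a / ?m)"
      using a le by (simp add: ln_div)
    finally have "a * ln (a / ?m) \<le> a * ((a - b) / a * ln 2)"
      using a by (intro mult_left_mono) (auto simp: ln_div)
    then have 1: "a * ln (a / ?m) \<le> (a - b) * ln 2" using a by simp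
    have 2: "b * ln (b / ?m) \<le> 0"
    proof (cases "b = 0")
      case False
      then have "b / ?m \<le> 1" "0 < b / ?m" using le a by (auto simp: field_simps)
      then show ?thesis using le by (intro mult_nonneg_nonpos) (auto simp only: ln_le_zero_iff)
    qed simp
    have "ent2 b a = (a * ln (a / ?m) + b * ln (b / ?m)) / 2"
      unfolding ent2_commute[of b a] using le a by (intro ent2_eq) auto
    also have "\<dots> \<le> ((a - b) * ln 2) / 2" using 1 2 by simp
    finally show ?thesis using le by (simp add: mult.commute)
  qed
next
  case (sym a b)
  then show ?case by (simp add: ent2_commute[of b a] abs_minus_commute)
qed

lemma ent2_le_square:
  assumes "0 \<le> a" "0 \<le> b"
  shows "ent2 a b \<le> (\<bar>a - b\<bar> / 2)\<^sup>2 / ((a + b) / 2)"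
proof (cases "a + b = 0")
  case True
  then have "a = 0" "b = 0" using assms by auto
  then show ?thesis by simp
next
  case False
  then have ab: "a + b > 0" using assms by simp
  let ?m = "(a + b) / 2"
  have "ent2 a b = (a * ln (a / ?m) + b * ln (b / ?m)) / 2"
    by (rule ent2_eq) (use assms ab in auto)
  also have "\<dots> \<le> (a * (a / ?m - 1) + b * (b / ?m - 1)) / 2"
    using assms ab by (intro divide_right_mono add_mono mult_ln_div_le) auto
  also have "\<dots> = (\<bar>a - b\<bar> / 2)\<^sup>2 / ?m"
    using ab by (simp add: power_divide power2_eq_square divide_simps) (simp add: algebra_simps)
  finally show ?thesis .
qed

lemma mult_ln_div_ge:
  assumes "0 \<le> a" "0 < m"
  shows "2 * (a - sqrt m * sqrt a) \<le> a * ln (a / m)"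
proof (cases "a = 0")
  case False
  then have a: "a > 0" using assms by simp
  have "ln (sqrt (m / a)) \<le> sqrt (m / a) - 1" using a assms by (intro ln_le_minus_one) simp
  then have "ln (m / a) \<le> 2 * (sqrt (m / a) - 1)" using a assms by (simp add: ln_sqrt)
  then have "a * ln (m / a) \<le> a * (2 * (sqrt (m / a) - 1))" using a by (intro mult_left_mono) auto
  moreover have "a * sqrt (m / a) = sqrt m * sqrt a"
    using a by (simp add: real_sqrt_divide) (metis real_div_sqrt less_eq_real_def mult.commute times_divide_eq_right)
  ultimately show ?thesis using a assms by (simp add: ln_div algebra_simps)
qed auto

text \<open>\<open>mult_ln_div_ge\<close> bounds the entropy below by a Hellinger-type distance. Two
  uses of AM-GM, on \<open>m\<close> and \<open>P\<close> and on \<open>sqrt m\<close> and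
  \<open>Q\<close>, compare that with the square.\<close>

lemma ent2_ge_square:
  assumes "0 \<le> a" "0 \<le> b"
  shows "(\<bar>a - b\<bar> / 2)\<^sup>2 / (4 * ((a + b) / 2)) \<le> ent2 a b"
proof (cases "a + b = 0")
  case True
  then have "a = 0" "b = 0" using assms by auto
  then show ?thesis by simp
next
  case False
  define m w P Q where "m = (a + b) / 2" and "w = \<bar>a - b\<bar> / 2"
    and "P = sqrt a * sqrt b" and "Q = sqrt a + sqrt b"
  have m: "m > 0" using False assms by (simp add: m_def)
  have "0 \<le> (m - P)\<^sup>2" by simp
  moreover have "P\<^sup>2 = m\<^sup>2 - w\<^sup>2"
    using assms by (simp add: P_def m_def w_def power_mult_distrib power_divide)
      (simp add: field_simps power2_eq_square)
  ultimately have 1: "m * P \<le> m\<^sup>2 - w\<^sup>2 / 2" by (simp add: power2_eq_square algebra_simps)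
  have "0 \<le> (2 * sqrt m - Q)\<^sup>2" by simp
  then have 2: "sqrt m * Q \<le> m + Q\<^sup>2 / 4" using m by (simp add: power2_diff power_mult_distrib)
  have 3: "Q\<^sup>2 = 2 * m + 2 * P"
    using assms by (simp add: Q_def m_def P_def power2_eq_square algebra_simps)
  have "w\<^sup>2 / (4 * m) \<le> (m - P) / 2"
    using 1 m by (simp add: field_simps power2_eq_square)
  also have "\<dots> \<le> 2 * m - sqrt m * Q"
    using 2 3 by (simp add: add_divide_distrib diff_divide_distrib)
  also have "\<dots> = (2 * (a - sqrt m * sqrt a) + 2 * (b - sqrt m * sqrt b)) / 2"
    by (simp add: m_def Q_def algebra_simps)
  also have "\<dots> \<le> ent2 a b"
    using mult_ln_div_ge[OF assms(1) m] mult_ln_div_ge[OF assms(2) m] m assms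
    by (simp add: ent2_eq m_def)
  finally show ?thesis by (simp add: w_def m_def)
qed

lemma ent2_nonneg: "0 \<le> a \<Longrightarrow> 0 \<le> b \<Longrightarrow> 0 \<le> ent2 a b"
  by (rule order_trans[OF _ ent2_ge_square]) auto

text \<open>The two-point logarithmic Sobolev inequality. It follows from the quadratic bound, since
  (a - b)^2 factors through square roots and (sqrt a + sqrt b)^2 is at most 2 (a + b).\<close>

lemma ent2_le_sqrt:
  assumes "0 \<le> a" "0 \<le> b"
  shows "ent2 a b \<le> (sqrt a - sqrt b)\<^sup>2"
proof (cases "a + b = 0")
  case True
  then have "a = 0" "b = 0" using assms by auto
  then show ?thesis by simp
next
  case False
  then have ab: "a + b > 0" using assms by simp
  define D where "D = (sqrt a - sqrt b)\<^sup>2"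
  have "(a - b)\<^sup>2 = D * (sqrt a + sqrt b)\<^sup>2"
    using assms by (simp add: D_def power_mult_distrib[symmetric] algebra_simps)
  also have "(sqrt a + sqrt b)\<^sup>2 = 2 * (a + b) - D"
    using assms by (simp add: D_def power2_eq_square algebra_simps)
  also have "D * (2 * (a + b) - D) \<le> 2 * (a + b) * D"
    by (simp add: algebra_simps)
  finally have "(a - b)\<^sup>2 \<le> 2 * (a + b) * (sqrt a - sqrt b)\<^sup>2"
    by (simp only: D_def)
  then have "(\<bar>a - b\<bar> / 2)\<^sup>2 / ((a + b) / 2) \<le> (sqrt a - sqrt b)\<^sup>2"
    using ab by (simp add: power_divide field_simps)
  then show ?thesis using ent2_le_square[OF assms] by simp
qed

section \<open>Entropy of marginals: chain rule, subadditivity, logarithmic Sobolev\<close>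

lemma mean_ent_insert:
  assumes i: "i \<in> {1..n}" "i \<notin> S"
  shows "mean n (\<lambda>x. cond_mean n (insert i S) F x * ln (cond_mean n (insert i S) F x))
    = mean n (\<lambda>x. cond_mean n S F x * ln (cond_mean n S F x))
    + mean n (\<lambda>x. ent2 (cond_mean n (insert i S) F x) (cond_mean n (insert i S) F (flip x i)))"
proof -
  let ?g = "cond_mean n (insert i S) F"
  have "mean n (\<lambda>x. ?g x * ln (?g x)) = mean n (\<lambda>x. (?g x * ln (?g x) + ?g (flip x i) * ln (?g (flip x i))) / 2)"
    by (rule mean_pair[OF i(1)])
  also have "\<dots> = mean n (\<lambda>x. cond_mean n S F x * ln (cond_mean n S F x) + ent2 (?g x) (?g (flip x i)))"
  proof (rule mean_cong)
    fix x assume "x \<in> cube n"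
    from cond_mean_insert[OF this i, of F]
    show "(?g x * ln (?g x) + ?g (flip x i) * ln (?g (flip x i))) / 2 =
      cond_mean n S F x * ln (cond_mean n S F x) + ent2 (?g x) (?g (flip x i))"
      by (simp only: ent2_def)
  qed
  finally show ?thesis by (simp only: mean_add)
qed

lemma mean_abs_diff_cond_mean_le:
  assumes "S \<subseteq> {1..n}" "i \<in> S" "\<And>x. x \<in> cube n \<Longrightarrow> 0 \<le> F x"
  shows "mean n (\<lambda>x. \<bar>cond_mean n S F x - cond_mean n S F (flip x i)\<bar>)
    \<le> mean n (\<lambda>x. \<bar>F x - F (flip x i)\<bar>)"
proof -
  have convex: "\<bar>(a + a') / 2 - (b + b') / 2\<bar> \<le> (\<bar>a - b\<bar> + \<bar>a' - b'\<bar>) / 2" for a a' b b' :: real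
    by (simp add: add_divide_distrib diff_divide_distrib abs_if)
  show ?thesis
    by (intro cond_mean_contraction[where F = F and \<Theta> = "\<lambda>a b. \<bar>a - b\<bar>"] assms convex)
qed

text \<open>In bits, revealing \<open>i\<close> gains at most h_i whatever is already known: the
  two-point bound is linear in the L1 difference, which shrinks under averaging.\<close>

lemma mean_ent2_le:
  assumes "S \<subseteq> {1..n}" "i \<in> S" and F: "\<And>x. x \<in> cube n \<Longrightarrow> 0 \<le> F x"
  shows "mean n (\<lambda>x. ent2 (cond_mean n S F x) (cond_mean n S F (flip x i)))
    \<le> ln 2 * (mean n (\<lambda>x. \<bar>F x - F (flip x i)\<bar>) / 2)"
proof -
  have i: "i \<in> {1..n}" using assms by auto
  have "mean n (\<lambda>x. ent2 (cond_mean n S F x) (cond_mean n S F (flip x i)))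
    \<le> mean n (\<lambda>x. ln 2 * (\<bar>cond_mean n S F x - cond_mean n S F (flip x i)\<bar> / 2))"
    by (intro mean_mono ent2_le_ln2 cond_mean_nonneg F flip_in_cube i)
  also have "\<dots> = ln 2 * (mean n (\<lambda>x. \<bar>cond_mean n S F x - cond_mean n S F (flip x i)\<bar>) / 2)"
    by (simp only: mean_cmult mean_divide)
  also have "\<dots> \<le> ln 2 * (mean n (\<lambda>x. \<bar>F x - F (flip x i)\<bar>) / 2)"
    by (intro mult_left_mono divide_right_mono mean_abs_diff_cond_mean_le assms) auto
  finally show ?thesis .
qed

text \<open>Telescopes the chain rule from \<open>S\<close> to the full set. The bound
  \<open>c i\<close> must hold for every set containing \<open>i\<close>, so the order of insertion
  does not matter.\<close>

lemma mean_ent_le_sum: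
  assumes S: "S \<subseteq> {1..n}"
    and c: "\<And>S i. S \<subseteq> {1..n} \<Longrightarrow> i \<in> S \<Longrightarrow>
      mean n (\<lambda>x. ent2 (cond_mean n S F x) (cond_mean n S F (flip x i))) \<le> c i"
  shows "mean n (\<lambda>x. F x * ln (F x))
    \<le> mean n (\<lambda>x. cond_mean n S F x * ln (cond_mean n S F x)) + (\<Sum>i\<in>{1..n} - S. c i)"
  using S
proof (induction rule: subset_insert_induct)
  case full
  then show ?case by (auto intro!: eq_refl mean_cong simp: cond_mean_full)
next
  case (step S i)
  have "(\<Sum>i\<in>{1..n} - S. c i) = c i + (\<Sum>i\<in>{1..n} - insert i S. c i)"
    using step.hyps by (subst sum.remove[of _ i]) (auto intro!: sum.cong)
  then show ?case
    using step.IH mean_ent_insert[OF step.hyps(2,3), of F] c[of "insert i S" i] step.hyps by simp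
qed

text \<open>Tensorisation: the two-point inequality bounds each increment of the chain rule by the
  energy of a marginal, and joint convexity of (sqrt a - sqrt b)^2 bounds that by the energy of
  \<open>F\<close>.\<close>

lemma log_sobolev:
  assumes F: "\<And>x. x \<in> cube n \<Longrightarrow> 0 \<le> F x"
  shows "mean n (\<lambda>x. F x * ln (F x)) - mean n F * ln (mean n F)
    \<le> (\<Sum>i\<in>{1..n}. mean n (\<lambda>x. (sqrt (F x) - sqrt (F (flip x i)))\<^sup>2))"
proof -
  have convex: "(sqrt ((a + a') / 2) - sqrt ((b + b') / 2))\<^sup>2
      \<le> ((sqrt a - sqrt b)\<^sup>2 + (sqrt a' - sqrt b')\<^sup>2) / 2"
    if "0 \<le> a" "0 \<le> a'" "0 \<le> b" "0 \<le> b'" for a a' b b' :: real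
  proof -
    \<comment> \<open>Cauchy-Schwarz for (sqrt a, sqrt a') and (sqrt b, sqrt b').\<close>
    have "(sqrt a * sqrt b + sqrt a' * sqrt b')\<^sup>2 \<le> ((sqrt a)\<^sup>2 + (sqrt a')\<^sup>2) * ((sqrt b)\<^sup>2 + (sqrt b')\<^sup>2)"
      using zero_le_power2[of "sqrt a * sqrt b' - sqrt a' * sqrt b"]
      by (simp add: power2_eq_square algebra_simps)
    also have "\<dots> = (2 * (sqrt ((a + a') / 2) * sqrt ((b + b') / 2)))\<^sup>2"
      using that by (simp add: power_mult_distrib)
    finally have "sqrt a * sqrt b + sqrt a' * sqrt b' \<le> 2 * (sqrt ((a + a') / 2) * sqrt ((b + b') / 2))"
      by (rule power2_le_imp_le) (use that in auto)
    then show ?thesis using that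
      by (simp add: power2_diff) (simp add: field_simps)
  qed
  have "mean n (\<lambda>x. F x * ln (F x))
    \<le> mean n (\<lambda>x. cond_mean n {} F x * ln (cond_mean n {} F x))
      + (\<Sum>i\<in>{1..n} - {}. mean n (\<lambda>x. (sqrt (F x) - sqrt (F (flip x i)))\<^sup>2))"
  proof (rule mean_ent_le_sum)
    fix S i assume S: "S \<subseteq> {1..n}" "i \<in> S"
    then have i: "i \<in> {1..n}" by auto
    have "mean n (\<lambda>x. ent2 (cond_mean n S F x) (cond_mean n S F (flip x i)))
      \<le> mean n (\<lambda>x. (sqrt (cond_mean n S F x) - sqrt (cond_mean n S F (flip x i)))\<^sup>2)"
      by (intro mean_mono ent2_le_sqrt cond_mean_nonneg F flip_in_cube i)
    also have "\<dots> \<le> mean n (\<lambda>x. (sqrt (F x) - sqrt (F (flip x i)))\<^sup>2)"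
      by (intro cond_mean_contraction[OF S, where F = F and \<Theta> = "\<lambda>a b. (sqrt a - sqrt b)\<^sup>2"] F convex)
    finally show "mean n (\<lambda>x. ent2 (cond_mean n S F x) (cond_mean n S F (flip x i)))
      \<le> mean n (\<lambda>x. (sqrt (F x) - sqrt (F (flip x i)))\<^sup>2)" .
  qed simp
  then show ?thesis by simp
qed

section \<open>The inequality of Falik and Samorodnitsky\<close>

text \<open>Pythagoras for the averaging projection in direction \<open>i\<close>.\<close>

lemma mean_square_split:
  assumes i: "i \<in> {1..n}"
    and A: "\<And>x. x \<in> cube n \<Longrightarrow> A x = (q x + q (flip x i)) / 2"
  shows "mean n (\<lambda>x. (A x)\<^sup>2) + mean n (\<lambda>x. (q x - A x)\<^sup>2) = mean n (\<lambda>x. (q x)\<^sup>2)"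
proof -
  have "mean n (\<lambda>x. (A x)\<^sup>2) + mean n (\<lambda>x. (q x - A x)\<^sup>2)
    = mean n (\<lambda>x. (A x)\<^sup>2 + (q x - A x)\<^sup>2)"
    by (simp only: mean_add)
  also have "\<dots> = mean n (\<lambda>x. ((q x)\<^sup>2 + (q (flip x i))\<^sup>2) / 2)"
  proof (rule mean_cong)
    fix x assume "x \<in> cube n"
    show "(A x)\<^sup>2 + (q x - A x)\<^sup>2 = ((q x)\<^sup>2 + (q (flip x i))\<^sup>2) / 2"
      unfolding A[OF \<open>x \<in> cube n\<close>] by (simp add: power2_eq_square field_simps)
  qed
  also have "\<dots> = mean n (\<lambda>x. (q x)\<^sup>2)"
    by (rule mean_pair[OF i, symmetric])
  finally show ?thesis .
qed

lemma mean_eq_0_iff: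
  assumes "\<And>x. x \<in> cube n \<Longrightarrow> 0 \<le> F x"
  shows "mean n F = 0 \<longleftrightarrow> (\<forall>x\<in>cube n. F x = 0)"
  unfolding mean_def using assms by (simp add: sum_nonneg_eq_0_iff)

text \<open>With q = E D^2 and r = E |D|, the entropy of D^2 is at least q ln (q / r^2). Linearising
  this logarithm at scale \<open>t\<close> makes the bound linear in q and r^2, so that it can be
  summed over many functions with one \<open>t\<close>.\<close>

lemma entropy_ge_l1:
  assumes "t > 0"
  shows "mean n (\<lambda>x. (D x)\<^sup>2) * (ln t + 1) - t * (mean n (\<lambda>x. \<bar>D x\<bar>))\<^sup>2
    \<le> mean n (\<lambda>x. (D x)\<^sup>2 * ln ((D x)\<^sup>2)) - mean n (\<lambda>x. (D x)\<^sup>2) * ln (mean n (\<lambda>x. (D x)\<^sup>2))"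
proof (cases "\<forall>x\<in>cube n. D x = 0")
  case True
  then have "mean n (\<lambda>x. (D x)\<^sup>2) = 0" "mean n (\<lambda>x. \<bar>D x\<bar>) = 0"
    "mean n (\<lambda>x. (D x)\<^sup>2 * ln ((D x)\<^sup>2)) = 0"
    by (simp_all add: mean_def)
  then show ?thesis by simp
next
  case False
  define q r where "q = mean n (\<lambda>x. (D x)\<^sup>2)" and "r = mean n (\<lambda>x. \<bar>D x\<bar>)"
  have "q \<noteq> 0" "r \<noteq> 0"
    unfolding q_def r_def using False by (subst mean_eq_0_iff; auto)+
  moreover have "q \<ge> 0" "r \<ge> 0" unfolding q_def r_def by (auto intro: mean_nonneg)
  ultimately have q: "q > 0" and r: "r > 0" by auto
  have pt: "(D x)\<^sup>2 * (ln q - ln r) - (D x)\<^sup>2 * ln ((D x)\<^sup>2) / 2 \<le> q / r * \<bar>D x\<bar> - (D x)\<^sup>2" for x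
  proof (cases "D x = 0")
    case False
    have "ln (q / (r * \<bar>D x\<bar>)) \<le> q / (r * \<bar>D x\<bar>) - 1"
      using q r False by (intro ln_le_minus_one) auto
    then have "(D x)\<^sup>2 * ln (q / (r * \<bar>D x\<bar>)) \<le> (D x)\<^sup>2 * (q / (r * \<bar>D x\<bar>) - 1)"
      by (intro mult_left_mono) auto
    moreover have "ln (q / (r * \<bar>D x\<bar>)) = ln q - ln r - ln \<bar>D x\<bar>"
      using q r False by (simp add: ln_div ln_mult)
    moreover have "ln ((D x)\<^sup>2) = 2 * ln \<bar>D x\<bar>"
      using ln_realpow[of "\<bar>D x\<bar>" 2] False by simp
    moreover have "(D x)\<^sup>2 * (q / (r * \<bar>D x\<bar>)) = q / r * \<bar>D x\<bar>"
    proof -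
      have "z\<^sup>2 * (q / (r * z)) = q / r * z" if "z > 0" for z
        using that r by (simp add: power2_eq_square)
      from this[of "\<bar>D x\<bar>"] show ?thesis using False by simp
    qed
    ultimately show ?thesis by (simp add: algebra_simps)
  qed simp
  have "mean n (\<lambda>x. (ln q - ln r) * (D x)\<^sup>2 - (D x)\<^sup>2 * ln ((D x)\<^sup>2) / 2)
    \<le> mean n (\<lambda>x. q / r * \<bar>D x\<bar> - (D x)\<^sup>2)"
    using pt by (intro mean_mono) (simp add: mult.commute)
  then have "(ln q - ln r) * q - mean n (\<lambda>x. (D x)\<^sup>2 * ln ((D x)\<^sup>2)) / 2 \<le> q / r * r - q"
    by (simp only: mean_diff mean_cmult mean_divide q_def[symmetric] r_def[symmetric])
  then have 1: "2 * (ln q - ln r) * q \<le> mean n (\<lambda>x. (D x)\<^sup>2 * ln ((D x)\<^sup>2))"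
    using r by (simp add: algebra_simps)
  have "q * ln (t * r\<^sup>2 / q) \<le> q * (t * r\<^sup>2 / q - 1)"
    using assms q r by (intro mult_left_mono ln_le_minus_one) auto
  also have "\<dots> = t * r\<^sup>2 - q" using q by (simp add: field_simps)
  also have "ln (t * r\<^sup>2 / q) = ln t + 2 * ln r - ln q"
    using assms q r by (simp add: ln_div ln_mult ln_realpow)
  finally show ?thesis
    using 1 by (simp add: algebra_simps flip: q_def r_def)
qed

text \<open>\<open>log_sobolev\<close> and \<open>entropy_ge_l1\<close> are applied to each
  martingale difference \<open>d k\<close> and summed: the second moments add up to the variance and
  the energies to the energy of \<open>\<psi>\<close>.\<close>

lemma falik_samorodnitsky:
  assumes \<psi>: "\<And>x. x \<in> cube n \<Longrightarrow> 0 \<le> \<psi> x" and "t > 0"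
  shows "(mean n (\<lambda>x. (\<psi> x)\<^sup>2) - (mean n \<psi>)\<^sup>2) * (ln t + 1)
      - t * (\<Sum>i\<in>{1..n}. (mean n (\<lambda>x. \<bar>\<psi> x - \<psi> (flip x i)\<bar>) / 2)\<^sup>2)
    \<le> (\<Sum>i\<in>{1..n}. mean n (\<lambda>x. (\<psi> x - \<psi> (flip x i))\<^sup>2))"
proof -
  define P where "P k = cond_mean n {1..k} \<psi>" for k
  define d where "d k x = P (Suc k) x - P k x" for k x
  define e where "e i x = \<psi> x - \<psi> (flip x i)" for i x
  have P: "P k x = (P (Suc k) x + P (Suc k) (flip x (Suc k))) / 2" if "x \<in> cube n" "k < n" for k x
    using cond_mean_insert[OF that(1), of "Suc k" "{1..k}" \<psi>] that(2)
    by (simp add: P_def atLeastAtMostSuc_conv)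
  have P0: "P 0 x = mean n \<psi>" and Pn: "x \<in> cube n \<Longrightarrow> P n x = \<psi> x" for x
    by (simp_all add: P_def)
  have var: "(\<Sum>k<n. mean n (\<lambda>x. (d k x)\<^sup>2)) = mean n (\<lambda>x. (\<psi> x)\<^sup>2) - (mean n \<psi>)\<^sup>2"
  proof -
    have "(\<Sum>k<n. mean n (\<lambda>x. (d k x)\<^sup>2))
      = (\<Sum>k<n. mean n (\<lambda>x. (P (Suc k) x)\<^sup>2) - mean n (\<lambda>x. (P k x)\<^sup>2))"
    proof (rule sum.cong)
      fix k assume "k \<in> {..<n}"
      then show "mean n (\<lambda>x. (d k x)\<^sup>2) = mean n (\<lambda>x. (P (Suc k) x)\<^sup>2) - mean n (\<lambda>x. (P k x)\<^sup>2)"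
        using mean_square_split[of "Suc k" n "P k" "P (Suc k)"] P by (simp add: d_def)
    qed simp
    also have "\<dots> = mean n (\<lambda>x. (P n x)\<^sup>2) - mean n (\<lambda>x. (P 0 x)\<^sup>2)"
      by (rule sum_lessThan_telescope)
    also have "mean n (\<lambda>x. (P n x)\<^sup>2) = mean n (\<lambda>x. (\<psi> x)\<^sup>2)"
      by (rule mean_cong) (simp add: Pn)
    finally show ?thesis by (simp add: P0)
  qed
  \<comment> \<open>For fixed \<open>i\<close> the differences \<open>Q k\<close> across direction
    \<open>i\<close> again form a martingale, starting at 0, so their squared increments
    telescope.\<close>
  have energy: "(\<Sum>k<n. mean n (\<lambda>x. (d k x - d k (flip x i))\<^sup>2)) = mean n (\<lambda>x. (e i x)\<^sup>2)"
    if i: "i \<in> {1..n}" for i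
  proof -
    define Q where "Q k x = P k x - P k (flip x i)" for k x
    have "(\<Sum>k<n. mean n (\<lambda>x. (d k x - d k (flip x i))\<^sup>2))
      = (\<Sum>k<n. mean n (\<lambda>x. (Q (Suc k) x)\<^sup>2) - mean n (\<lambda>x. (Q k x)\<^sup>2))"
    proof (rule sum.cong)
      fix k assume "k \<in> {..<n}"
      then have k: "Suc k \<in> {1..n}" "k < n" by auto
      have "Q k x = (Q (Suc k) x + Q (Suc k) (flip x (Suc k))) / 2" if "x \<in> cube n" for x
        using P[OF that k(2)] P[OF flip_in_cube[OF that i] k(2)]
        unfolding Q_def flip_commute[of x i "Suc k"] by (simp add: field_simps)
      from mean_square_split[OF k(1), of "Q k" "Q (Suc k)", OF this]
      show "mean n (\<lambda>x. (d k x - d k (flip x i))\<^sup>2)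
        = mean n (\<lambda>x. (Q (Suc k) x)\<^sup>2) - mean n (\<lambda>x. (Q k x)\<^sup>2)"
        by (simp add: d_def Q_def algebra_simps)
    qed simp
    also have "\<dots> = mean n (\<lambda>x. (Q n x)\<^sup>2) - mean n (\<lambda>x. (Q 0 x)\<^sup>2)"
      by (rule sum_lessThan_telescope)
    also have "mean n (\<lambda>x. (Q n x)\<^sup>2) = mean n (\<lambda>x. (e i x)\<^sup>2)"
      by (rule mean_cong) (simp add: Q_def e_def Pn flip_in_cube[OF _ i])
    finally show ?thesis by (simp add: Q_def P0)
  qed
  have l1: "mean n (\<lambda>x. \<bar>d k x\<bar>) \<le> mean n (\<lambda>x. \<bar>e (Suc k) x\<bar>) / 2" if k: "k < n" for k
  proof -
    have "mean n (\<lambda>x. \<bar>d k x\<bar>) = mean n (\<lambda>x. \<bar>P (Suc k) x - P (Suc k) (flip x (Suc k))\<bar>) / 2"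
      unfolding mean_divide[symmetric]
      by (rule mean_cong) (simp add: d_def P[OF _ k] abs_if field_simps)
    also have "\<dots> \<le> mean n (\<lambda>x. \<bar>e (Suc k) x\<bar>) / 2"
      unfolding P_def e_def
      by (intro divide_right_mono mean_abs_diff_cond_mean_le \<psi>) (use k in auto)
    finally show ?thesis .
  qed
  have step: "mean n (\<lambda>x. (d k x)\<^sup>2) * (ln t + 1) - t * (mean n (\<lambda>x. \<bar>e (Suc k) x\<bar>) / 2)\<^sup>2
      \<le> (\<Sum>i\<in>{1..n}. mean n (\<lambda>x. (d k x - d k (flip x i))\<^sup>2))" if k: "k < n" for k
  proof -
    have "t * (mean n (\<lambda>x. \<bar>d k x\<bar>))\<^sup>2 \<le> t * (mean n (\<lambda>x. \<bar>e (Suc k) x\<bar>) / 2)\<^sup>2"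
      using l1[OF k] \<open>t > 0\<close> by (intro mult_left_mono power_mono mean_nonneg) auto
    then have "mean n (\<lambda>x. (d k x)\<^sup>2) * (ln t + 1) - t * (mean n (\<lambda>x. \<bar>e (Suc k) x\<bar>) / 2)\<^sup>2
      \<le> mean n (\<lambda>x. (d k x)\<^sup>2) * (ln t + 1) - t * (mean n (\<lambda>x. \<bar>d k x\<bar>))\<^sup>2" by simp
    also note entropy_ge_l1[OF \<open>t > 0\<close>]
    also note log_sobolev[of n "\<lambda>x. (d k x)\<^sup>2", OF zero_le_power2]
    also have "(\<Sum>i\<in>{1..n}. mean n (\<lambda>x. (sqrt ((d k x)\<^sup>2) - sqrt ((d k (flip x i))\<^sup>2))\<^sup>2))
      \<le> (\<Sum>i\<in>{1..n}. mean n (\<lambda>x. (d k x - d k (flip x i))\<^sup>2))"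
    proof (intro sum_mono mean_mono)
      fix i x
      have "\<bar>\<bar>d k x\<bar> - \<bar>d k (flip x i)\<bar>\<bar> \<le> \<bar>d k x - d k (flip x i)\<bar>" by simp
      then show "(sqrt ((d k x)\<^sup>2) - sqrt ((d k (flip x i))\<^sup>2))\<^sup>2 \<le> (d k x - d k (flip x i))\<^sup>2"
        by (simp add: abs_le_square_iff)
    qed
    finally show ?thesis .
  qed
  have "(\<Sum>k<n. mean n (\<lambda>x. (d k x)\<^sup>2) * (ln t + 1) - t * (mean n (\<lambda>x. \<bar>e (Suc k) x\<bar>) / 2)\<^sup>2)
      \<le> (\<Sum>k<n. \<Sum>i\<in>{1..n}. mean n (\<lambda>x. (d k x - d k (flip x i))\<^sup>2))"
    using step by (intro sum_mono) auto
  also have "\<dots> = (\<Sum>i\<in>{1..n}. mean n (\<lambda>x. (e i x)\<^sup>2))"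
    by (subst sum.swap) (intro sum.cong energy refl)
  also have "(\<Sum>k<n. mean n (\<lambda>x. (d k x)\<^sup>2) * (ln t + 1) - t * (mean n (\<lambda>x. \<bar>e (Suc k) x\<bar>) / 2)\<^sup>2)
    = (mean n (\<lambda>x. (\<psi> x)\<^sup>2) - (mean n \<psi>)\<^sup>2) * (ln t + 1)
      - t * (\<Sum>k<n. (mean n (\<lambda>x. \<bar>e (Suc k) x\<bar>) / 2)\<^sup>2)"
    by (simp only: sum_subtractf sum_distrib_left sum_distrib_right var[symmetric])
  \<comment> \<open>The difference \<open>d k\<close> belongs to coordinate \<open>Suc k\<close>,
    hence the shift.\<close>
  also have "(\<Sum>k<n. (mean n (\<lambda>x. \<bar>e (Suc k) x\<bar>) / 2)\<^sup>2) = (\<Sum>i\<in>{1..n}. (mean n (\<lambda>x. \<bar>e i x\<bar>) / 2)\<^sup>2)"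
    by (rule sum.reindex_bij_witness[of _ "\<lambda>i. i - 1" Suc]) auto
  finally show ?thesis unfolding e_def .
qed

section \<open>A marginal that is far from uniform\<close>

text \<open>
  Gibbs' inequality against the measure that has the same marginal on \<open>S\<close> and makes the remaining
  coordinates conditionally independent.
\<close>

lemma conditional_gibbs:
  assumes S: "S \<subseteq> {1..n}"
    and F: "\<And>x. x \<in> cube n \<Longrightarrow> 0 \<le> F x" "\<And>x. x \<in> cube n \<Longrightarrow> F x \<le> B" and "B > 0"
    and w: "\<And>z. 0 \<le> w z"
  shows "(\<Sum>i\<in>{1..n} - S. mean n (\<lambda>x. w (cond_mean n S F x) *
        ent2 (cond_mean n (insert i S) F x) (cond_mean n (insert i S) F (flip x i))))
    \<le> mean n (\<lambda>x. w (cond_mean n S F x) * ((ln B - ln (cond_mean n S F x)) * cond_mean n S F x))"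
proof -
  define g where "g = cond_mean n S F"
  define G where "G i = cond_mean n (insert i S) F" for i
  define R where "R = {1..n} - S"
  have R: "finite R" by (simp add: R_def)
  have iR: "i \<in> {1..n}" "i \<notin> S" if "i \<in> R" for i
    using that by (auto simp: R_def)
  have g_flip: "g (flip x i) = g x" if "i \<notin> S" for x i
    unfolding g_def by (rule cond_mean_flip[OF that])
  have G_flip: "G j (flip x i) = G j x" if "i \<notin> S" "i \<noteq> j" for x i j
    unfolding G_def by (rule cond_mean_flip) (use that in auto)
  have g: "g x = (G i x + G i (flip x i)) / 2" if "x \<in> cube n" "i \<in> R" for x i
    unfolding g_def G_def using cond_mean_insert[OF that(1) iR[OF that(2)]] .
  have g0: "0 \<le> g x" and G0: "0 \<le> G i x" if "x \<in> cube n" for x i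
    unfolding g_def G_def by (rule cond_mean_nonneg[OF that F(1)]; assumption)+
  \<comment> \<open>The weight and the log ratio depend only on the coordinates in
    \<open>insert i S\<close>, so \<open>F\<close> may be replaced by its marginal
    \<open>G i\<close>; pairing along \<open>i\<close> then produces \<open>ent2\<close>.\<close>
  have marginal: "mean n (\<lambda>x. w (g x) * ent2 (G i x) (G i (flip x i)))
      = mean n (\<lambda>x. w (g x) * (F x * ln (G i x / g x)))" if i: "i \<in> R" for i
  proof -
    have "mean n (\<lambda>x. w (g x) * (F x * ln (G i x / g x)))
      = mean n (\<lambda>x. (w (g x) * ln (G i x / g x)) * F x)"
      by (simp add: mult_ac)
    also have "\<dots> = mean n (\<lambda>x. (w (g x) * ln (G i x / g x)) * G i x)"
      unfolding G_def
      by (rule mean_cond_mean_mult[symmetric])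
        (use S i in \<open>auto simp: R_def g_flip G_flip simp flip: G_def\<close>)
    also have "\<dots> = mean n (\<lambda>x. ((w (g x) * ln (G i x / g x)) * G i x
        + (w (g (flip x i)) * ln (G i (flip x i) / g (flip x i))) * G i (flip x i)) / 2)"
      by (rule mean_pair[OF iR(1)[OF i]])
    also have "\<dots> = mean n (\<lambda>x. w (g x) * ent2 (G i x) (G i (flip x i)))"
    proof (rule mean_cong)
      fix x assume x: "x \<in> cube n"
      have a: "0 \<le> G i x" and b: "0 \<le> G i (flip x i)"
        using x iR(1)[OF i] by (auto intro!: G0 flip_in_cube)
      show "((w (g x) * ln (G i x / g x)) * G i x
        + (w (g (flip x i)) * ln (G i (flip x i) / g (flip x i))) * G i (flip x i)) / 2
        = w (g x) * ent2 (G i x) (G i (flip x i))"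
      proof (cases "G i x + G i (flip x i) = 0")
        case True
        then have "G i x = 0" "G i (flip x i) = 0" using a b by auto
        then show ?thesis by simp
      next
        case False
        then have "ent2 (G i x) (G i (flip x i))
          = (G i x * ln (G i x / g x) + G i (flip x i) * ln (G i (flip x i) / g x)) / 2"
          using ent2_eq[OF a b, folded g[OF x i]] a b by simp
        then show ?thesis
          unfolding g_flip[OF iR(2)[OF i]] by (simp only:) (simp add: algebra_simps)
      qed
    qed
    finally show ?thesis by simp
  qed
  \<comment> \<open>The comparison measure has the right weighted mass: averaging along
    \<open>j\<close> turns the factor \<open>G j x / g x\<close> into 1. Where
    \<open>g x = 0\<close>, both sides vanish.\<close>
  have product: "mean n (\<lambda>x. w (g x) * (g x * (\<Prod>i\<in>J. G i x / g x))) = mean n (\<lambda>x. w (g x) * g x)"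
    if "J \<subseteq> R" for J
    using finite_subset[OF that R] that
  proof (induction J rule: finite_induct)
    case (insert j J)
    then have j: "j \<in> R" "j \<notin> J" "J \<subseteq> R" by auto
    note j' = iR[OF j(1)]
    have J_flip: "(\<Prod>i\<in>J. G i (flip x j) / g x) = (\<Prod>i\<in>J. G i x / g x)" for x
      by (rule prod.cong) (use j j' in \<open>auto intro!: arg_cong2[of _ _ _ _ "(/)"] G_flip\<close>)
    have "mean n (\<lambda>x. w (g x) * (g x * (\<Prod>i\<in>insert j J. G i x / g x)))
      = mean n (\<lambda>x. w (g x) * (g x * (\<Prod>i\<in>J. G i x / g x)))"
    proof (subst mean_pair[OF j'(1)], intro mean_cong)
      fix x assume x: "x \<in> cube n"
      show "(w (g x) * (g x * (\<Prod>i\<in>insert j J. G i x / g x))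
        + w (g (flip x j)) * (g (flip x j) * (\<Prod>i\<in>insert j J. G i (flip x j) / g (flip x j)))) / 2
        = w (g x) * (g x * (\<Prod>i\<in>J. G i x / g x))"
      proof (cases "g x = 0")
        case False
        define p where "p = w (g x) * (\<Prod>i\<in>J. G i x / g x)"
        have "p * G j x + p * G j (flip x j) = 2 * (p * g x)"
          using g[OF x j(1)] by (simp add: algebra_simps)
        then show ?thesis
          using False insert.hyps by (simp add: J_flip g_flip[OF j'(2)] p_def mult_ac)
      qed (simp add: g_flip[OF j'(2)])
    qed
    then show ?case using insert j by simp
  qed simp
  \<comment> \<open>Gibbs pointwise: ln z \<le> z - 1 for the ratio \<open>z\<close> of the
    comparison density to \<open>B\<close>, followed by F \<le> B. Where \<open>F x > 0\<close>, all
    marginals are positive, so the logarithms split.\<close>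
  have pt: "w (g x) * (\<Sum>i\<in>R. F x * ln (G i x / g x)) - (w (g x) * (ln B - ln (g x))) * F x
      \<le> w (g x) * (g x * (\<Prod>i\<in>R. G i x / g x)) - w (g x) * F x" if x: "x \<in> cube n" for x
  proof -
    have "(\<Sum>i\<in>R. F x * ln (G i x / g x)) - (ln B - ln (g x)) * F x
      \<le> g x * (\<Prod>i\<in>R. G i x / g x) - F x"
    proof (cases "F x = 0")
      case True
      have "0 \<le> g x * (\<Prod>i\<in>R. G i x / g x)"
        using x by (intro mult_nonneg_nonneg prod_nonneg divide_nonneg_nonneg ballI g0 G0)
      then show ?thesis using True by simp
    next
      case False
      then have Fx: "F x > 0" using F(1)[OF x] by simp
      have gx: "g x > 0" and Gx: "G i x > 0" for i
        unfolding g_def G_def using cond_mean_pos[of x n F, OF x F(1) Fx] by auto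
      define z where "z = g x * (\<Prod>i\<in>R. G i x / g x) / B"
      have z: "z > 0" unfolding z_def using gx Gx \<open>B > 0\<close> by (auto intro!: divide_pos_pos mult_pos_pos prod_pos)
      have "ln (\<Prod>i\<in>R. G i x / g x) = (\<Sum>i\<in>R. ln (G i x / g x))"
        by (rule ln_prod[OF R]) (metis Gx divide_pos_pos gx less_irrefl)
      moreover have "0 < (\<Prod>i\<in>R. G i x / g x)" using gx Gx by (intro prod_pos) auto
      ultimately have "ln z = ln (g x) + (\<Sum>i\<in>R. ln (G i x / g x)) - ln B"
        unfolding z_def using gx \<open>B > 0\<close> by (simp add: ln_div ln_mult)
      then have "F x * (ln (g x) + (\<Sum>i\<in>R. ln (G i x / g x)) - ln B) \<le> F x * (z - 1)"
        using Fx ln_le_minus_one[OF z] by (intro mult_left_mono) auto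
      also have "\<dots> \<le> B * z - F x"
        using mult_right_mono[OF F(2)[OF x], of z] z by (simp add: algebra_simps)
      also have "B * z = g x * (\<Prod>i\<in>R. G i x / g x)" unfolding z_def using \<open>B > 0\<close> by simp
      finally show ?thesis by (simp add: algebra_simps sum_distrib_left)
    qed
    from mult_left_mono[OF this w[of "g x"]] show ?thesis by (simp add: algebra_simps)
  qed
  have S_flip: "w (g (flip x i)) * (ln B - ln (g (flip x i))) = w (g x) * (ln B - ln (g x))"
    "w (g (flip x i)) = w (g x)" if "i \<notin> S" for x i
    by (simp_all add: g_flip[OF that])
  have "mean n (\<lambda>x. w (g x) * (\<Sum>i\<in>R. F x * ln (G i x / g x)))
      - mean n (\<lambda>x. (w (g x) * (ln B - ln (g x))) * F x)
    \<le> mean n (\<lambda>x. w (g x) * (g x * (\<Prod>i\<in>R. G i x / g x))) - mean n (\<lambda>x. w (g x) * F x)"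
    using mean_mono[of n, OF pt] by (simp only: mean_diff)
  also have "mean n (\<lambda>x. w (g x) * F x) = mean n (\<lambda>x. w (g x) * g x)"
    using mean_cond_mean_mult[OF S, of "\<lambda>x. w (g x)" F] S_flip by (simp add: g_def)
  also have "mean n (\<lambda>x. w (g x) * (g x * (\<Prod>i\<in>R. G i x / g x))) = mean n (\<lambda>x. w (g x) * g x)"
    by (rule product) simp
  also have "mean n (\<lambda>x. (w (g x) * (ln B - ln (g x))) * F x)
      = mean n (\<lambda>x. (w (g x) * (ln B - ln (g x))) * g x)"
    using mean_cond_mean_mult[OF S, of "\<lambda>x. w (g x) * (ln B - ln (g x))" F] S_flip by (simp add: g_def)
  finally have "mean n (\<lambda>x. w (g x) * (\<Sum>i\<in>R. F x * ln (G i x / g x)))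
    \<le> mean n (\<lambda>x. w (g x) * ((ln B - ln (g x)) * g x))" by (simp add: mult.assoc)
  moreover have "mean n (\<lambda>x. w (g x) * (\<Sum>i\<in>R. F x * ln (G i x / g x)))
    = (\<Sum>i\<in>R. mean n (\<lambda>x. w (g x) * ent2 (G i x) (G i (flip x i))))"
    unfolding sum_distrib_left mean_sum by (intro sum.cong marginal[symmetric] refl)
  ultimately show ?thesis by (simp add: g_def G_def R_def)
qed

text \<open>If the maximal \<open>S\<close> had a marginal close to 1, the coordinates outside it
  would need much of their entropy on points where that marginal is far from 1.
  \<open>conditional_gibbs\<close> allows too little entropy there when \<open>ln B\<close> is
  large; when \<open>ln B\<close> is O(K + 1), the full set works.\<close>

lemma exists_nonuniform_marginal:
  fixes n :: nat and F :: "(nat \<Rightarrow> nat) \<Rightarrow> real" and K B :: real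
  defines "h \<equiv> \<lambda>i. mean n (\<lambda>x. \<bar>F x - F (flip x i)\<bar>) / 2"
  assumes F: "\<And>x. x \<in> cube n \<Longrightarrow> 0 \<le> F x" "\<And>x. x \<in> cube n \<Longrightarrow> F x \<le> B" and B: "1 \<le> B"
    and mean_F: "mean n F = 1"
    and ent_F: "mean n (\<lambda>x. F x * ln (F x)) = ln B"
    and total: "ln 2 * (\<Sum>i\<in>{1..n}. h i) \<le> ln B + ln 2 * K"
    and far: "1 / 512 \<le> mean n (\<lambda>x. \<bar>F x - 1\<bar>) / 2"
  shows "K \<ge> 0" and "\<exists>S\<subseteq>{1..n}. (\<Sum>i\<in>S. h i) \<le> 192 * (K + 1)
    \<and> 1 / 512 \<le> mean n (\<lambda>x. \<bar>cond_mean n S F x - 1\<bar>) / 2"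
proof -
  define ent where "ent S = mean n (\<lambda>x. cond_mean n S F x * ln (cond_mean n S F x))" for S
  define dev where "dev S = mean n (\<lambda>x. \<bar>cond_mean n S F x - 1\<bar>) / 2" for S
  define H where "H S = (\<Sum>i\<in>S. h i)" for S
  have h0: "0 \<le> h i" for i unfolding h_def by (intro divide_nonneg_nonneg mean_nonneg) auto
  have ln2: "2 / 3 \<le> ln (2::real)" "ln (2::real) \<le> 7 / 10"
    using ln2_ge_two_thirds ln2_le_25_over_36 by auto
  have incr: "mean n (\<lambda>x. ent2 (cond_mean n S F x) (cond_mean n S F (flip x i))) \<le> ln 2 * h i"
    if "S \<subseteq> {1..n}" "i \<in> S" for S i
    unfolding h_def by (rule mean_ent2_le[OF that F(1)])
  have ent_le: "ln B \<le> ent S + ln 2 * H ({1..n} - S)" if "S \<subseteq> {1..n}" for S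
    using mean_ent_le_sum[OF that incr] ent_F by (simp add: ent_def H_def sum_distrib_left)
  have ent_empty: "ent {} = 0" by (simp add: ent_def mean_F)
  \<comment> \<open>Subadditivity from the empty set is the edge-isoperimetric inequality, so the
    hypothesis leaves no room for negative \<open>K\<close>.\<close>
  show K0: "K \<ge> 0"
  proof -
    have "0 \<le> ln 2 * K" using ent_le[of "{}"] total ent_empty by (simp add: H_def)
    then show ?thesis by (simp add: zero_le_mult_iff)
  qed
  have H_split: "H {1..n} = H S + H ({1..n} - S)" if "S \<subseteq> {1..n}" for S
    unfolding H_def by (rule sum.subset_diff[OF that, THEN trans]) auto
  have H_insert: "H (insert i S) = h i + H S" if "S \<subseteq> {1..n}" "i \<notin> S" for i S
    unfolding H_def using that finite_subset by (subst sum.insert) auto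
  have "\<exists>S\<subseteq>{1..n}. H S \<le> 192 * (K + 1) \<and> 1 / 512 \<le> dev S"
  \<comment> \<open>The threshold is what the other case needs: there H S \<le> 16 (K + 2) and H R
    \<le> ln B / 2 + 32, while ln B \<le> H S + H R. The constant 192 is 128 * 3 / 2.\<close>
  proof (cases "ln B \<le> 32 * (K + 4)")
    case True
    have "2 / 3 * H {1..n} \<le> ln 2 * H {1..n}"
      using ln2 h0 by (intro mult_right_mono) (auto simp: H_def sum_nonneg)
    also have "\<dots> \<le> 32 * (K + 4) + ln 2 * K" using total True by (simp add: H_def)
    also have "\<dots> \<le> 32 * (K + 4) + 7 / 10 * K" using ln2 K0 by (intro add_left_mono mult_right_mono) auto
    finally have "H {1..n} \<le> 192 * (K + 1)" using K0 by simp
    moreover have "dev {1..n} = mean n (\<lambda>x. \<bar>F x - 1\<bar>) / 2"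
      unfolding dev_def by (intro arg_cong2[of _ _ _ _ "(/)"] mean_cong) auto
    ultimately show ?thesis using far by auto
  next
    case False
    \<comment> \<open>Entropy loss plus deviation: including \<open>dev\<close> lets maximality
      limit its growth as well.\<close>
    define \<Phi> where "\<Phi> S = ln 2 * H S - ent S + dev S" for S
    define \<A> where "\<A> = {S. S \<subseteq> {1..n} \<and> ln 2 / 16 * H S \<le> \<Phi> S}"
    have "finite \<A>" unfolding \<A>_def by (rule finite_subset[of _ "Pow {1..n}"]) auto
    moreover have "{} \<in> \<A>" by (simp add: \<A>_def \<Phi>_def H_def ent_empty dev_def mean_F)
    ultimately obtain S where "S \<in> \<A>" and max: "\<forall>T\<in>\<A>. S \<subseteq> T \<longrightarrow> S = T"
      using finite_has_maximal[of \<A>] by auto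
    then have S: "S \<subseteq> {1..n}" and \<Phi>S: "ln 2 / 16 * H S \<le> \<Phi> S" by (auto simp: \<A>_def)
    define g where "g = cond_mean n S F"
    define R where "R = {1..n} - S"
    have g0: "0 \<le> g x" if "x \<in> cube n" for x
      unfolding g_def by (rule cond_mean_nonneg[OF that F(1)])
    have mean_g: "mean n g = 1" unfolding g_def by (simp add: mean_cond_mean[OF S] mean_F)
    have dev_le: "dev S \<le> 1"
    proof -
      have "mean n (\<lambda>x. \<bar>g x - 1\<bar>) \<le> mean n (\<lambda>x. g x + 1)"
        by (rule mean_mono) (use g0 in \<open>force simp: abs_if\<close>)
      then show ?thesis by (simp add: dev_def mean_add mean_g flip: g_def)
    qed
    \<comment> \<open>Subadditivity on the complement bounds the loss of \<open>S\<close> by the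
      total loss, at most \<open>ln 2 * K\<close>; the deviation adds at most 1.\<close>
    have HS: "H S \<le> 16 * (K + 2)"
    proof -
      have "\<Phi> S \<le> ln 2 * K + 1"
        using dev_le ent_le[OF S] total H_split[OF S] by (simp add: \<Phi>_def H_def algebra_simps)
      then have "ln 2 * H S \<le> ln 2 * (16 * (K + 2))"
        using \<Phi>S ln2 by (simp add: algebra_simps)
      then show ?thesis by simp
    qed
    have "1 / 512 \<le> dev S"
    proof (rule ccontr)
      assume "\<not> 1 / 512 \<le> dev S"
      then have dev: "dev S < 1 / 512" by simp
      define a b where "a i x = cond_mean n (insert i S) F x"
        and "b i x = cond_mean n (insert i S) F (flip x i)" for i x
      define e where "e i = mean n (\<lambda>x. ent2 (a i x) (b i x))" for i
      \<comment> \<open>Marks the values far from 1; for these z \<le> 4 |z - 1|.\<close>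
      define ind :: "real \<Rightarrow> real" where "ind z = (if \<bar>z - 1\<bar> \<le> z / 4 then 0 else 1)" for z
      have a0: "0 \<le> a i x" and b0: "i \<in> R \<Longrightarrow> 0 \<le> b i x" if "x \<in> cube n" for i x
        unfolding a_def b_def R_def using that by (auto intro!: cond_mean_nonneg F(1))
      have g: "g x = (a i x + b i x) / 2" if "x \<in> cube n" "i \<in> R" for x i
        unfolding g_def a_def b_def
        by (rule cond_mean_insert[OF that(1)]) (use that in \<open>auto simp: R_def\<close>)
      have e_le: "e i \<le> ln 2 * h i" if "i \<in> R" for i
        using incr[of "insert i S" i] that S by (simp add: e_def a_def b_def R_def)
      \<comment> \<open>By maximality \<open>\<Phi>\<close> grows by less than
        \<open>ln 2 / 16 * h i\<close>. Loss and deviation both grow by nonnegative amounts, so each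
        obeys this bound.\<close>
      have grow: "15 / 16 * (ln 2 * h i) \<le> e i \<and> dev (insert i S) - dev S \<le> ln 2 / 16 * h i" if i: "i \<in> R"
        and mono: "dev S \<le> dev (insert i S)" for i
      proof -
        have i': "i \<in> {1..n}" "i \<notin> S" using i by (auto simp: R_def)
        then have "insert i S \<notin> \<A>" using max by blast
        then have "\<Phi> (insert i S) < ln 2 / 16 * (h i + H S)"
          using S i' by (simp add: \<A>_def H_insert)
        moreover have "\<Phi> (insert i S) = \<Phi> S + ln 2 * h i - e i + (dev (insert i S) - dev S)"
          using mean_ent_insert[OF i', of F] i' S
          by (simp add: \<Phi>_def ent_def H_insert e_def a_def b_def algebra_simps)
        ultimately show ?thesis using \<Phi>S e_le[OF i] mono by (simp add: algebra_simps)
      qed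
      have dev_insert: "dev (insert i S) = mean n (\<lambda>x. (\<bar>a i x - 1\<bar> + \<bar>b i x - 1\<bar>) / 4)" if "i \<in> R" for i
        using mean_pair[of i n "\<lambda>x. \<bar>cond_mean n (insert i S) F x - 1\<bar>"] that
        by (simp add: dev_def a_def b_def R_def flip: mean_divide)
      have dev_S: "dev S = mean n (\<lambda>x. \<bar>g x - 1\<bar> / 2)"
        by (simp add: dev_def mean_divide g_def)
      \<comment> \<open>Entropy above half of w = |p - q| / 2 must move the deviation, unless
        \<open>m\<close> is far from 1. If 2 w < m, the entropy is at most w / 2. Otherwise the
        first two terms give at most w / 4, paid for by the deviation when \<open>m\<close> is near
        1 and by the \<open>ind\<close> term when it is not.\<close>
      have key: "5 / 4 * ent2 p q - 5 / 8 * (\<bar>p - q\<bar> / 2) - 2 * (ind m * ent2 p q)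
          \<le> (\<bar>p - 1\<bar> + \<bar>q - 1\<bar>) / 4 - \<bar>m - 1\<bar> / 2"
        and key0: "\<bar>m - 1\<bar> / 2 \<le> (\<bar>p - 1\<bar> + \<bar>q - 1\<bar>) / 4"
        if pq: "0 \<le> p" "0 \<le> q" "m = (p + q) / 2" for p q m
      proof -
        define w where "w = \<bar>p - q\<bar> / 2"
        show 0: "\<bar>m - 1\<bar> / 2 \<le> (\<bar>p - 1\<bar> + \<bar>q - 1\<bar>) / 4"
          unfolding pq(3) by (simp add: abs_if field_simps)
        define X where "X = (\<bar>p - 1\<bar> + \<bar>q - 1\<bar>) / 4 - \<bar>m - 1\<bar> / 2"
        have X0: "0 \<le> X" using 0 by (simp add: X_def)
        have X1: "w / 2 - \<bar>m - 1\<bar> / 2 \<le> X"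
          unfolding w_def X_def by (simp add: abs_if field_simps)
        have E0: "0 \<le> ent2 p q" and E1: "ent2 p q \<le> ln 2 * w" and E2: "ent2 p q \<le> w\<^sup>2 / m"
          and E3: "w\<^sup>2 / (4 * m) \<le> ent2 p q"
          using ent2_nonneg[OF pq(1,2)] ent2_le_ln2[OF pq(1,2)] ent2_le_square[OF pq(1,2)]
            ent2_ge_square[OF pq(1,2)] by (simp_all add: w_def pq(3))
        have w0: "0 \<le> w" by (simp add: w_def)
        have "5 / 4 * ent2 p q - 5 / 8 * w - 2 * (ind m * ent2 p q) \<le> X"
        proof (cases "2 * w < m")
          case True
          then have "w * (2 * w) \<le> w * m" "m > 0" using w0 by (auto intro: mult_left_mono)
          then have "w\<^sup>2 / m \<le> w / 2" by (simp add: field_simps power2_eq_square)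
          moreover have "0 \<le> ind m * ent2 p q" using E0 by (simp add: ind_def)
          ultimately show ?thesis using E2 X0 by linarith
        next
          case False
          have 5: "5 * ent2 p q - 5 / 2 * w \<le> w"
            using E1 mult_right_mono[OF ln2(2) w0] by simp
          show ?thesis
          proof (cases "\<bar>m - 1\<bar> \<le> m / 4")
            case True
            then show ?thesis using X1 5 False by (simp add: ind_def)
          next
            case far: False
            have "w / 8 \<le> w\<^sup>2 / (4 * m)"
            proof (cases "m > 0")
              case True
              have "w * m \<le> w * (2 * w)" using False w0 by (intro mult_left_mono) auto
              then show ?thesis using True by (simp add: field_simps power2_eq_square)
            next
              case neg: False
              then have "p = 0" "q = 0" using pq by auto
              then show ?thesis by (simp add: w_def)
            qed
            then have "w \<le> 8 * ent2 p q" using E3 by linarith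
            then show ?thesis using 5 X0 far by (simp add: ind_def)
          qed
        qed
        then show "5 / 4 * ent2 p q - 5 / 8 * (\<bar>p - q\<bar> / 2) - 2 * (ind m * ent2 p q)
          \<le> (\<bar>p - 1\<bar> + \<bar>q - 1\<bar>) / 4 - \<bar>m - 1\<bar> / 2" by (simp only: w_def X_def)
      qed
      \<comment> \<open>The mean of \<open>key\<close>: by \<open>grow\<close> the entropy is at
        least 5/8 \<open>h i\<close>, and 5/4 * 5/8 - 5/8 = 5/32 leaves room for the 1/8.\<close>
      have each: "h i / 8 - 2 * mean n (\<lambda>x. ind (g x) * ent2 (a i x) (b i x)) \<le> h i / 16" if i: "i \<in> R" for i
      proof -
        have ab: "0 \<le> a i x" "0 \<le> b i x" "g x = (a i x + b i x) / 2" if "x \<in> cube n" for x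
          using a0 b0 g that i by auto
        have mono: "dev S \<le> dev (insert i S)"
          unfolding dev_insert[OF i] dev_S by (intro mean_mono key0 ab)
        have w: "mean n (\<lambda>x. \<bar>a i x - b i x\<bar> / 2) \<le> h i"
        proof -
          have "mean n (\<lambda>x. \<bar>a i x - b i x\<bar>) \<le> mean n (\<lambda>x. \<bar>F x - F (flip x i)\<bar>)"
            unfolding a_def b_def
            by (rule mean_abs_diff_cond_mean_le) (use i S F(1) in \<open>auto simp: R_def\<close>)
          then show ?thesis by (simp add: h_def mean_divide)
        qed
        have "mean n (\<lambda>x. 5 / 4 * ent2 (a i x) (b i x) - 5 / 8 * (\<bar>a i x - b i x\<bar> / 2)
            - 2 * (ind (g x) * ent2 (a i x) (b i x)))
          \<le> mean n (\<lambda>x. (\<bar>a i x - 1\<bar> + \<bar>b i x - 1\<bar>) / 4 - \<bar>g x - 1\<bar> / 2)"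
          by (intro mean_mono key ab)
        then have "5 / 4 * e i - 5 / 8 * mean n (\<lambda>x. \<bar>a i x - b i x\<bar> / 2)
            - 2 * mean n (\<lambda>x. ind (g x) * ent2 (a i x) (b i x)) \<le> dev (insert i S) - dev S"
          by (simp only: mean_diff mean_divide mean_cmult dev_insert[OF i] dev_S e_def)
        moreover have "25 / 8 * h i \<le> 5 * e i"
          using grow[OF i mono] mult_right_mono[OF ln2(1) h0[of i]] by simp
        moreover have "dev (insert i S) - dev S \<le> h i / 16"
          using grow[OF i mono] mult_right_mono[OF ln2(2) h0[of i]] h0[of i] by simp
        ultimately show ?thesis using w h0[of i] by simp
      qed
      have "(\<Sum>i\<in>R. mean n (\<lambda>x. ind (g x) * ent2 (a i x) (b i x)))
        \<le> mean n (\<lambda>x. ind (g x) * ((ln B - ln (g x)) * g x))"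
        unfolding R_def a_def b_def g_def
        by (rule conditional_gibbs[OF S F]) (use B in \<open>auto simp: ind_def\<close>)
      \<comment> \<open>On marked points g \<le> 4 |g - 1| controls the \<open>ln B\<close> term,
        and - g ln g \<le> 1 the rest.\<close>
      also have "\<dots> \<le> mean n (\<lambda>x. (8 * ln B) * (\<bar>g x - 1\<bar> / 2) + 1)"
      proof (rule mean_mono)
        fix x assume x: "x \<in> cube n"
        note gx = g0[OF x]
        have lnB: "0 \<le> ln B" using B by simp
        have "- (g x * ln (g x)) \<le> 1"
        proof (cases "g x = 0")
          case False
          then have "ln (1 / g x) \<le> 1 / g x - 1" using gx by (intro ln_le_minus_one) auto
          then have "g x * ln (1 / g x) \<le> g x * (1 / g x - 1)" using gx by (rule mult_left_mono)
          then show ?thesis using False gx by (simp add: ln_div algebra_simps)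
        qed simp
        moreover have "ln B * g x \<le> ln B * (4 * \<bar>g x - 1\<bar>)" if "\<not> \<bar>g x - 1\<bar> \<le> g x / 4"
          using that lnB by (intro mult_left_mono) auto
        ultimately show "ind (g x) * ((ln B - ln (g x)) * g x) \<le> (8 * ln B) * (\<bar>g x - 1\<bar> / 2) + 1"
          using lnB by (auto simp: ind_def algebra_simps)
      qed
      also have "\<dots> = 8 * ln B * dev S + 1"
        by (simp only: mean_add mean_cmult mean_const dev_S)
      finally have bad: "(\<Sum>i\<in>R. mean n (\<lambda>x. ind (g x) * ent2 (a i x) (b i x))) \<le> 8 * ln B * dev S + 1" .
      have "(\<Sum>i\<in>R. h i / 8 - 2 * mean n (\<lambda>x. ind (g x) * ent2 (a i x) (b i x))) \<le> (\<Sum>i\<in>R. h i / 16)"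
        by (intro sum_mono each)
      then have "H R / 8 - 2 * (\<Sum>i\<in>R. mean n (\<lambda>x. ind (g x) * ent2 (a i x) (b i x))) \<le> H R / 16"
        by (simp add: sum_subtractf H_def sum_divide_distrib sum_distrib_left)
      then have "H R / 16 \<le> 16 * (ln B * dev S) + 2" using bad by simp
      also have "ln B * dev S \<le> ln B * (1 / 512)"
        using dev B by (intro mult_left_mono) auto
      finally have "H R / 16 \<le> ln B / 32 + 2" by simp
      moreover have "ln B \<le> H {1..n}"
      proof -
        have "ln B \<le> ln 2 * H {1..n}" using ent_le[of "{}"] ent_empty by simp
        also have "\<dots> \<le> 1 * H {1..n}"
          using ln2 h0 by (intro mult_right_mono) (auto simp: H_def sum_nonneg)
        finally show ?thesis by simp
      qed
      ultimately show False using HS H_split[OF S] False by (simp add: R_def)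
    qed
    moreover have "H S \<le> 192 * (K + 1)" using HS K0 by simp
    ultimately show ?thesis using S by blast
  qed
  then show "\<exists>S\<subseteq>{1..n}. (\<Sum>i\<in>S. h i) \<le> 192 * (K + 1)
    \<and> 1 / 512 \<le> mean n (\<lambda>x. \<bar>cond_mean n S F x - 1\<bar>) / 2"
    unfolding H_def dev_def .
qed

section \<open>Influences\<close>

text \<open>The square of sqrt (1 + g) has mean 2, so with \<open>m\<close> its mean the variance 2
  - m^2 is at least half of the mean square distance of sqrt (1 + g) from sqrt 2. Only the part of
  \<open>g\<close> below 1 is used for the latter: its mean deficit \<open>p\<close> is half the L1
  distance of \<open>g\<close> from 1.\<close>

lemma variance_sqrt_ge:
  assumes g: "\<And>x. x \<in> cube n \<Longrightarrow> 0 \<le> g x" and mean_g: "mean n g = 1"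
    and dev: "c \<le> mean n (\<lambda>x. \<bar>g x - 1\<bar>) / 2" "0 \<le> c"
  shows "c\<^sup>2 / 16 \<le> mean n (\<lambda>x. (sqrt (1 + g x))\<^sup>2) - (mean n (\<lambda>x. sqrt (1 + g x)))\<^sup>2"
proof -
  define m where "m = mean n (\<lambda>x. sqrt (1 + g x))"
  define p where "p x = max (1 - g x) 0" for x
  have sq: "mean n (\<lambda>x. (sqrt (1 + g x))\<^sup>2) = 2"
  proof -
    have "mean n (\<lambda>x. (sqrt (1 + g x))\<^sup>2) = mean n (\<lambda>x. 1 + g x)"
      by (rule mean_cong) (use g in \<open>simp add: add_nonneg_nonneg\<close>)
    then show ?thesis by (simp add: mean_add mean_g)
  qed
  have "c \<le> mean n p"
  proof -
    have "mean n (\<lambda>x. \<bar>g x - 1\<bar>) = mean n (\<lambda>x. 2 * p x + (g x - 1))"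
      by (rule mean_cong) (simp add: p_def max_def)
    then show ?thesis using dev by (simp add: mean_add mean_diff mean_cmult mean_g)
  qed
  then have "c\<^sup>2 \<le> (mean n p)\<^sup>2" using dev(2) by (rule power_mono)
  also have "\<dots> \<le> mean n (\<lambda>x. (p x)\<^sup>2)" by (rule mean_square_le)
  also have "\<dots> \<le> mean n (\<lambda>x. 8 * (2 + (sqrt (1 + g x))\<^sup>2 - 2 * sqrt 2 * sqrt (1 + g x)))"
  proof (rule mean_mono)
    fix x assume x: "x \<in> cube n"
    define y where "y = sqrt (1 + g x)"
    have y: "0 \<le> y" "y\<^sup>2 = 1 + g x" using g[OF x] by (auto simp: y_def)
    have p: "p x \<le> 2 * sqrt 2 * \<bar>sqrt 2 - y\<bar>"
    proof (cases "g x \<le> 1")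
      case True
      then have "y \<le> sqrt 2" by (simp add: y_def)
      then have "(sqrt 2 - y) * (sqrt 2 + y) \<le> (sqrt 2 - y) * (2 * sqrt 2)"
        by (intro mult_left_mono) auto
      moreover have "(sqrt 2 - y) * (sqrt 2 + y) = 1 - g x"
        using y by (simp add: algebra_simps power2_eq_square)
      ultimately show ?thesis using True \<open>y \<le> sqrt 2\<close> by (simp add: p_def max_def mult.commute)
    qed (simp add: p_def max_def)
    have "(p x)\<^sup>2 \<le> (2 * sqrt 2 * \<bar>sqrt 2 - y\<bar>)\<^sup>2"
      using p by (rule power_mono) (simp add: p_def)
    also have "\<dots> = 8 * (2 + y\<^sup>2 - 2 * sqrt 2 * y)"
      by (simp add: power_mult_distrib power2_diff)
    finally show "(p x)\<^sup>2 \<le> 8 * (2 + (sqrt (1 + g x))\<^sup>2 - 2 * sqrt 2 * sqrt (1 + g x))"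
      by (simp only: y_def)
  qed
  also have "\<dots> = 8 * (2 + 2 - 2 * sqrt 2 * m)"
    by (simp only: mean_cmult mean_diff mean_add sq m_def mean_const)
  finally have 1: "c\<^sup>2 / 16 \<le> sqrt 2 * (sqrt 2 - m)" by (simp add: algebra_simps)
  have "m\<^sup>2 \<le> 2" using mean_square_le[of n "\<lambda>x. sqrt (1 + g x)"] sq by (simp add: m_def)
  then have "m \<le> sqrt 2" by (rule real_le_rsqrt)
  moreover have "0 \<le> m" unfolding m_def by (rule mean_nonneg) (use g in \<open>simp add: add_nonneg_nonneg\<close>)
  ultimately have "sqrt 2 * (sqrt 2 - m) \<le> (sqrt 2 + m) * (sqrt 2 - m)"
    by (intro mult_right_mono) auto
  also have "\<dots> = 2 - m\<^sup>2" by (simp add: algebra_simps power2_eq_square)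
  finally show ?thesis using 1 by (simp add: sq m_def)
qed

text \<open>\<open>falik_samorodnitsky\<close> with t = 1 / \<delta> for sqrt (1 + g). The shift by
  1 makes the root Lipschitz with constant 1/2, which controls L1 differences, while its squared
  differences stay linear in those of \<open>g\<close>. Energy contributes 2 h_i and the L1 term
  h_i, hence the 3.\<close>

lemma ln_inverse_influence_le:
  fixes n :: nat and F :: "(nat \<Rightarrow> nat) \<Rightarrow> real"
  defines "h \<equiv> \<lambda>i. mean n (\<lambda>x. \<bar>F x - F (flip x i)\<bar>) / 2"
  assumes F: "\<And>x. x \<in> cube n \<Longrightarrow> 0 \<le> F x" and mean_F: "mean n F = 1"
    and S: "S \<subseteq> {1..n}" and dev: "c \<le> mean n (\<lambda>x. \<bar>cond_mean n S F x - 1\<bar>) / 2" "0 \<le> c"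
    and \<delta>: "0 < \<delta>" "\<delta> \<le> 1" "\<And>i. i \<in> S \<Longrightarrow> h i \<le> \<delta>"
  shows "c\<^sup>2 / 16 * ln (1 / \<delta>) \<le> 3 * (\<Sum>i\<in>S. h i)"
proof -
  define g where "g = cond_mean n S F"
  define \<psi> where "\<psi> x = sqrt (1 + g x)" for x
  define v where "v = mean n (\<lambda>x. (\<psi> x)\<^sup>2) - (mean n \<psi>)\<^sup>2"
  have g0: "0 \<le> g x" if "x \<in> cube n" for x
    unfolding g_def by (rule cond_mean_nonneg[OF that F])
  have h0: "0 \<le> h i" for i unfolding h_def by (intro divide_nonneg_nonneg mean_nonneg) auto
  have v: "c\<^sup>2 / 16 \<le> v"
    unfolding v_def \<psi>_def using g0 dev
    by (intro variance_sqrt_ge) (simp_all add: g_def mean_cond_mean[OF S] mean_F)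
  have g_flip: "g (flip x i) = g x" if "i \<notin> S" for x i
    unfolding g_def by (rule cond_mean_flip[OF that])
  have g_l1: "mean n (\<lambda>x. \<bar>g x - g (flip x i)\<bar>) \<le> 2 * h i" if "i \<in> S" for i
    unfolding g_def h_def using mean_abs_diff_cond_mean_le[OF S that F] by simp
  have sqrt_diff: "(sqrt (1 + a) - sqrt (1 + b))\<^sup>2 \<le> \<bar>a - b\<bar>"
    "\<bar>sqrt (1 + a) - sqrt (1 + b)\<bar> \<le> \<bar>a - b\<bar> / 2" if "0 \<le> a" "0 \<le> b" for a b :: real
  proof -
    define u w where "u = sqrt (1 + a)" and "w = sqrt (1 + b)"
    have u: "1 \<le> u" "u\<^sup>2 = 1 + a" and w: "1 \<le> w" "w\<^sup>2 = 1 + b"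
      using that by (auto simp: u_def w_def)
    have eq: "\<bar>a - b\<bar> = \<bar>u - w\<bar> * (u + w)"
    proof -
      have "a - b = (u - w) * (u + w)" using u w by (simp add: power2_eq_square algebra_simps)
      then show ?thesis using u w by (simp add: abs_mult)
    qed
    have "\<bar>u - w\<bar> * \<bar>u - w\<bar> \<le> \<bar>u - w\<bar> * (u + w)"
      using u w by (intro mult_left_mono) auto
    then show "(sqrt (1 + a) - sqrt (1 + b))\<^sup>2 \<le> \<bar>a - b\<bar>"
      unfolding eq u_def[symmetric] w_def[symmetric] by (simp add: power2_eq_square)
    have "\<bar>u - w\<bar> * 2 \<le> \<bar>u - w\<bar> * (u + w)"
      using u w by (intro mult_left_mono) auto
    then show "\<bar>sqrt (1 + a) - sqrt (1 + b)\<bar> \<le> \<bar>a - b\<bar> / 2"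
      unfolding eq u_def[symmetric] w_def[symmetric] by simp
  qed
  have l2: "mean n (\<lambda>x. (\<psi> x - \<psi> (flip x i))\<^sup>2) \<le> 2 * h i"
    and l1: "(mean n (\<lambda>x. \<bar>\<psi> x - \<psi> (flip x i)\<bar>) / 2)\<^sup>2 \<le> \<delta> * h i" if i: "i \<in> S" for i
  proof -
    have i': "i \<in> {1..n}" using i S by auto
    have "mean n (\<lambda>x. (\<psi> x - \<psi> (flip x i))\<^sup>2) \<le> mean n (\<lambda>x. \<bar>g x - g (flip x i)\<bar>)"
      unfolding \<psi>_def by (intro mean_mono sqrt_diff g0 flip_in_cube i')
    then show "mean n (\<lambda>x. (\<psi> x - \<psi> (flip x i))\<^sup>2) \<le> 2 * h i" using g_l1[OF i] by simp
    have "mean n (\<lambda>x. \<bar>\<psi> x - \<psi> (flip x i)\<bar>) \<le> mean n (\<lambda>x. \<bar>g x - g (flip x i)\<bar> / 2)"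
      unfolding \<psi>_def by (intro mean_mono sqrt_diff g0 flip_in_cube i')
    then have "mean n (\<lambda>x. \<bar>\<psi> x - \<psi> (flip x i)\<bar>) / 2 \<le> h i"
      using g_l1[OF i] h0[of i] by (simp add: mean_divide)
    then have "(mean n (\<lambda>x. \<bar>\<psi> x - \<psi> (flip x i)\<bar>) / 2)\<^sup>2 \<le> (h i)\<^sup>2"
      by (rule power_mono) (auto intro!: mean_nonneg)
    also have "\<dots> \<le> \<delta> * h i"
      unfolding power2_eq_square using \<delta>(3)[OF i] h0 by (rule mult_right_mono)
    finally show "(mean n (\<lambda>x. \<bar>\<psi> x - \<psi> (flip x i)\<bar>) / 2)\<^sup>2 \<le> \<delta> * h i" .
  qed
  have outside: "\<psi> (flip x i) = \<psi> x" if "i \<notin> S" for x i by (simp add: \<psi>_def g_flip[OF that])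
  have "v * (ln (1 / \<delta>) + 1)
      - 1 / \<delta> * (\<Sum>i\<in>{1..n}. (mean n (\<lambda>x. \<bar>\<psi> x - \<psi> (flip x i)\<bar>) / 2)\<^sup>2)
    \<le> (\<Sum>i\<in>{1..n}. mean n (\<lambda>x. (\<psi> x - \<psi> (flip x i))\<^sup>2))"
    unfolding v_def
    by (rule falik_samorodnitsky) (use \<delta>(1) g0 in \<open>auto simp: \<psi>_def add_nonneg_nonneg\<close>)
  moreover have "(\<Sum>i\<in>{1..n}. mean n (\<lambda>x. (\<psi> x - \<psi> (flip x i))\<^sup>2)) \<le> 2 * (\<Sum>i\<in>S. h i)"
  proof -
    have "(\<Sum>i\<in>{1..n}. mean n (\<lambda>x. (\<psi> x - \<psi> (flip x i))\<^sup>2))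
      = (\<Sum>i\<in>S. mean n (\<lambda>x. (\<psi> x - \<psi> (flip x i))\<^sup>2))"
      by (rule sum.mono_neutral_right) (use S in \<open>auto simp: outside\<close>)
    also have "\<dots> \<le> (\<Sum>i\<in>S. 2 * h i)" by (rule sum_mono[OF l2])
    finally show ?thesis by (simp add: sum_distrib_left)
  qed
  moreover have "1 / \<delta> * (\<Sum>i\<in>{1..n}. (mean n (\<lambda>x. \<bar>\<psi> x - \<psi> (flip x i)\<bar>) / 2)\<^sup>2) \<le> (\<Sum>i\<in>S. h i)"
  proof -
    have "(\<Sum>i\<in>{1..n}. (mean n (\<lambda>x. \<bar>\<psi> x - \<psi> (flip x i)\<bar>) / 2)\<^sup>2)
      = (\<Sum>i\<in>S. (mean n (\<lambda>x. \<bar>\<psi> x - \<psi> (flip x i)\<bar>) / 2)\<^sup>2)"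
      by (rule sum.mono_neutral_right) (use S in \<open>auto simp: outside\<close>)
    also have "\<dots> \<le> (\<Sum>i\<in>S. \<delta> * h i)" by (rule sum_mono[OF l1])
    finally show ?thesis using \<delta>(1) by (simp add: field_simps flip: sum_distrib_left)
  qed
  ultimately have "v * (ln (1 / \<delta>) + 1) \<le> 3 * (\<Sum>i\<in>S. h i)" by linarith
  moreover have "c\<^sup>2 / 16 * ln (1 / \<delta>) \<le> v * (ln (1 / \<delta>) + 1)"
    using v \<delta> order_trans[OF _ v, of 0] by (intro mult_mono) (auto simp: ln_div)
  ultimately show ?thesis by linarith
qed

section \<open>Edge boundary and influences; choice of the constant\<close>

text \<open>A boundary edge determines its endpoint in \<open>A\<close> and its direction, so the
  pairs in \<open>P\<close> inject into the boundary. Influence counts both endpoints, hence the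
  factor 2.\<close>

lemma sum_influence_le:
  assumes A: "A \<subseteq> cube n"
  shows "(\<Sum>i\<in>{1..n}. influence n (indicator A) i) \<le> 2 * real (card (edge_boundary n A)) / 2 ^ n"
proof -
  define P where "P = (SIGMA i:{1..n}. {x \<in> A. flip x i \<notin> A})"
  have finA: "finite A" using A by (rule finite_subset) simp
  have card_flip: "card {x \<in> cube n. (indicator A x :: nat) \<noteq> indicator A (flip x i)} = 2 * card {x \<in> A. flip x i \<notin> A}"
    if i: "i \<in> {1..n}" for i
  proof -
    have "{x \<in> cube n. (indicator A x :: nat) \<noteq> indicator A (flip x i)}
      = {x \<in> A. flip x i \<notin> A} \<union> {x \<in> cube n. x \<notin> A \<and> flip x i \<in> A}"
      using A by (auto simp: indicator_def)
    moreover have bij: "bij_betw (\<lambda>x. flip x i) {x \<in> A. flip x i \<notin> A} {x \<in> cube n. x \<notin> A \<and> flip x i \<in> A}"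
      by (rule bij_betw_byWitness[where f' = "\<lambda>x. flip x i"]) (use A i in \<open>auto simp: subset_iff simp del: One_nat_def\<close>)
    moreover from bij_betw_same_card[OF bij]
    have "card {x \<in> cube n. x \<notin> A \<and> flip x i \<in> A} = card {x \<in> A. flip x i \<notin> A}" by simp
    moreover have "card ({x \<in> A. flip x i \<notin> A} \<union> {x \<in> cube n. x \<notin> A \<and> flip x i \<in> A})
      = card {x \<in> A. flip x i \<notin> A} + card {x \<in> cube n. x \<notin> A \<and> flip x i \<in> A}"
      by (rule card_Un_disjoint) (use finA in auto)
    ultimately show ?thesis by simp
  qed
  have "card P \<le> card (edge_boundary n A)"
  proof (rule card_inj_on_le[where f = "\<lambda>(i, x). {x, flip x i}"])
    show "inj_on (\<lambda>(i, x). {x, flip x i}) P"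
    proof (rule inj_onI, clarify)
      fix i x j y assume *: "(i, x) \<in> P" "(j, y) \<in> P" and eq: "{x, flip x i} = {y, flip y j}"
      then have x: "x \<in> A" "flip x i \<notin> A" and y: "y \<in> A" "flip y j \<notin> A"
        by (auto simp: P_def)
      with eq have xy: "x = y" and flips: "flip x i = flip y j" by (metis doubleton_eq_iff)+
      have "i \<in> {1..n}" "x \<in> cube n" using * A by (auto simp: P_def)
      then have "x i \<noteq> flip x i i" using cube_value[of x n i] by (auto simp: flip_def)
      moreover have "flip y j i = y i" if "i \<noteq> j" using that by (simp add: flip_def)
      ultimately have "i = j" using flips xy by metis
      with xy show "i = j \<and> x = y" by simp
    qed
    show "(\<lambda>(i, x). {x, flip x i}) ` P \<subseteq> edge_boundary n A"
    proof clarify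
      fix i x assume *: "(i, x) \<in> P"
      then have x: "x \<in> cube n" and i: "i \<in> {1..n}" and "x \<in> A" "flip x i \<notin> A" using A by (auto simp: P_def)
      have "{k \<in> {1..n}. x k \<noteq> flip x i k} = {i}"
        using i cube_value[OF x i] by (auto simp: flip_def)
      then have "card {k \<in> {1..n}. x k \<noteq> flip x i k} = 1" by (simp only:) simp
      then have "{x, flip x i} \<in> cube_edges n"
        unfolding cube_edges_def using x flip_in_cube[OF x i] by blast
      moreover have "{x, flip x i} \<inter> A = {x}" using \<open>x \<in> A\<close> \<open>flip x i \<notin> A\<close> by auto
      ultimately show "{x, flip x i} \<in> edge_boundary n A" by (simp add: edge_boundary_def)
    qed
    have "edge_boundary n A \<subseteq> Pow (cube n)" by (auto simp: edge_boundary_def cube_edges_def)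
    then show "finite (edge_boundary n A)" by (rule finite_subset) simp
  qed
  moreover have "card P = (\<Sum>i\<in>{1..n}. card {x \<in> A. flip x i \<notin> A})"
    unfolding P_def by (rule card_SigmaI) (use finA in auto)
  moreover have "(\<Sum>i\<in>{1..n}. influence n (indicator A) i)
    = 2 * real (\<Sum>i\<in>{1..n}. card {x \<in> A. flip x i \<notin> A}) / 2 ^ n"
  proof -
    have "influence n (indicator A) i = 2 * real (card {x \<in> A. flip x i \<notin> A}) / 2 ^ n" if "i \<in> {1..n}" for i
      unfolding influence_def card_flip[OF that] by simp
    then have "(\<Sum>i\<in>{1..n}. influence n (indicator A) i)
      = (\<Sum>i\<in>{1..n}. 2 * real (card {x \<in> A. flip x i \<notin> A}) / 2 ^ n)"
      by (rule sum.cong[OF refl])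
    then show ?thesis by (simp only: of_nat_sum sum_distrib_left sum_divide_distrib)
  qed
  ultimately show ?thesis
    by (simp only:) (intro divide_right_mono mult_left_mono of_nat_mono; simp)
qed

lemma mean_if:
  assumes "A \<subseteq> cube n"
  shows "mean n (\<lambda>x. if x \<in> A then c else d) = d + (c - d) * (real (card A) / 2 ^ n)"
proof -
  have "mean n (\<lambda>x. if x \<in> A then 1 else 0) = real (card A) / 2 ^ n"
    unfolding mean_def using assms by (simp add: sum.If_cases Int_absorb1)
  moreover have "mean n (\<lambda>x. if x \<in> A then c else d) = mean n (\<lambda>x. d + (c - d) * (if x \<in> A then 1 else 0))"
    by (rule mean_cong) simp
  ultimately show ?thesis by (simp only: mean_add mean_cmult mean_const)
qed

theorem theorem6p1:
  "\<exists>C::real. C > 0 \<and>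
    (\<forall>(n::nat) (K::real) (A::(nat \<Rightarrow> nat) set).
      A \<subseteq> cube n \<longrightarrow> A \<noteq> {} \<longrightarrow>
      real (card A) \<le> 7 / 8 * 2 ^ n \<longrightarrow>
      real (card (edge_boundary n A)) \<le> real (card A) * (log 2 (2 ^ n / real (card A)) + K) \<longrightarrow>
      Max ((\<lambda>i. influence n (indicator A) i) ` {1..n})
        \<ge> 2 powr (- C * (K + 1)\<^sup>2) * (real (card A) / 2 ^ n))"
proof (rule exI[of _ "1000 * 2 ^ 22"], intro conjI allI impI)
  fix n :: nat and K :: real and A :: "(nat \<Rightarrow> nat) set"
  assume A: "A \<subseteq> cube n" "A \<noteq> {}" and size: "real (card A) \<le> 7 / 8 * 2 ^ n"
    and boundary: "real (card (edge_boundary n A)) \<le> real (card A) * (log 2 (2 ^ n / real (card A)) + K)"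
  have N: "card A > 0" using A finite_subset[OF A(1)] by (simp add: card_gt_0_iff)
  define B where "B = 2 ^ n / real (card A)"
  have "real (card A) \<le> 2 ^ n" using size by (rule order_trans) simp
  then have B: "1 \<le> B" using N by (simp add: B_def le_divide_eq)
  have BN: "B * (real (card A) / 2 ^ n) = 1" using N by (simp add: B_def)
  \<comment> \<open>For n = 0 the size bound would force \<open>A\<close> to be empty; the maximum
    thus runs over a nonempty set.\<close>
  have n: "n \<noteq> 0" using N size by (cases n) auto
  define F where "F x = (if x \<in> A then B else 0)" for x
  \<comment> \<open>The factor 2^22 = 16 * 512^2 cancels c^2 / 16 at c = 1/512, and 1000 * 2/3
    exceeds 576 = 3 * 192.\<close>
  define \<delta> where "\<delta> = 2 powr (- (1000 * 2 ^ 22) * (K + 1)\<^sup>2)"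
  have infl: "mean n (\<lambda>x. \<bar>F x - F (flip x i)\<bar>) / 2 = B * influence n (indicator A) i / 2" for i
  proof -
    let ?D = "{x \<in> cube n. (indicator A x :: nat) \<noteq> indicator A (flip x i)}"
    have "mean n (\<lambda>x. \<bar>F x - F (flip x i)\<bar>) = mean n (\<lambda>x. if x \<in> ?D then B else 0)"
      by (rule mean_cong) (use B in \<open>auto simp: F_def indicator_def\<close>)
    also have "\<dots> = 0 + (B - 0) * (real (card ?D) / 2 ^ n)"
      by (rule mean_if) auto
    finally show ?thesis by (simp add: influence_def)
  qed
  have F: "0 \<le> F x" "F x \<le> B" for x using B by (auto simp: F_def)
  have mean_F: "mean n F = 1"
  proof -
    have "mean n F = 0 + (B - 0) * (real (card A) / 2 ^ n)"
      unfolding F_def[abs_def] by (rule mean_if[OF A(1)])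
    then show ?thesis by (simp only: BN diff_zero add_0)
  qed
  have ent_F: "mean n (\<lambda>x. F x * ln (F x)) = ln B"
  proof -
    have "mean n (\<lambda>x. F x * ln (F x)) = mean n (\<lambda>x. if x \<in> A then B * ln B else 0)"
      by (rule mean_cong) (simp add: F_def)
    also have "\<dots> = ln B * (B * (real (card A) / 2 ^ n))"
      by (simp add: mean_if[OF A(1)])
    finally show ?thesis by (simp only: BN mult_1_right)
  qed
  \<comment> \<open>The distance equals 1 - |A| / 2^n, which is at least 1/8.\<close>
  have far: "1 / 512 \<le> mean n (\<lambda>x. \<bar>F x - 1\<bar>) / 2"
  proof -
    have "mean n (\<lambda>x. \<bar>F x - 1\<bar>) = mean n (\<lambda>x. if x \<in> A then B - 1 else 1)"
      by (rule mean_cong) (use B in \<open>simp add: F_def\<close>)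
    also have "\<dots> = 1 + B * (real (card A) / 2 ^ n) - 2 * (real (card A) / 2 ^ n)"
      by (simp add: mean_if[OF A(1)] algebra_simps diff_divide_distrib)
    finally have "mean n (\<lambda>x. \<bar>F x - 1\<bar>) = 2 - 2 * (real (card A) / 2 ^ n)" by (simp only: BN)
    moreover have "real (card A) / 2 ^ n \<le> 7 / 8" using size by (simp add: field_simps)
    ultimately show ?thesis by simp
  qed
  have total: "ln 2 * (\<Sum>i\<in>{1..n}. mean n (\<lambda>x. \<bar>F x - F (flip x i)\<bar>) / 2) \<le> ln B + ln 2 * K"
  proof -
    have "(\<Sum>i\<in>{1..n}. mean n (\<lambda>x. \<bar>F x - F (flip x i)\<bar>) / 2)
      = B / 2 * (\<Sum>i\<in>{1..n}. influence n (indicator A) i)"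
      by (simp add: infl sum_distrib_left)
    also have "\<dots> \<le> B / 2 * (2 * real (card (edge_boundary n A)) / 2 ^ n)"
      using B by (intro mult_left_mono sum_influence_le[OF A(1)]) auto
    also have "\<dots> = real (card (edge_boundary n A)) / real (card A)"
      by (simp add: B_def)
    also have "\<dots> \<le> log 2 B + K"
      using boundary N by (simp add: B_def field_simps)
    finally have "ln 2 * (\<Sum>i\<in>{1..n}. mean n (\<lambda>x. \<bar>F x - F (flip x i)\<bar>) / 2) \<le> ln 2 * (log 2 B + K)"
      by (intro mult_left_mono) auto
    also have "\<dots> = ln B + ln 2 * K" by (simp add: log_def distrib_left)
    finally show ?thesis .
  qed
  note marginal = exists_nonuniform_marginal[of n F B K, OF F B mean_F ent_F total far]
  from marginal(1) have K: "0 \<le> K" .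
  from marginal(2) obtain S where S: "S \<subseteq> {1..n}"
    and HS: "(\<Sum>i\<in>S. mean n (\<lambda>x. \<bar>F x - F (flip x i)\<bar>) / 2) \<le> 192 * (K + 1)"
    and dev: "1 / 512 \<le> mean n (\<lambda>x. \<bar>cond_mean n S F x - 1\<bar>) / 2" by blast
  show "Max ((\<lambda>i. influence n (indicator A) i) ` {1..n})
        \<ge> 2 powr (- (1000 * 2 ^ 22) * (K + 1)\<^sup>2) * (real (card A) / 2 ^ n)"
  proof (rule ccontr)
    assume "\<not> ?thesis"
    then have small: "influence n (indicator A) i < \<delta> * (real (card A) / 2 ^ n)" if "i \<in> {1..n}" for i
      using that n by (subst (asm) not_le, subst (asm) Max_less_iff) (auto simp: \<delta>_def)
    have "\<delta> \<le> 2 powr 0" unfolding \<delta>_def by (rule powr_mono) auto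
    then have \<delta>: "0 < \<delta>" "\<delta> \<le> 1" by (auto simp: \<delta>_def)
    have "mean n (\<lambda>x. \<bar>F x - F (flip x i)\<bar>) / 2 \<le> \<delta>" if "i \<in> S" for i
    proof -
      have "B * influence n (indicator A) i \<le> B * (\<delta> * (real (card A) / 2 ^ n))"
        using small[of i] that S B by (intro mult_left_mono) auto
      also have "\<dots> = \<delta> * (B * (real (card A) / 2 ^ n))" by simp
      finally have "B * influence n (indicator A) i \<le> \<delta>" by (simp only: BN mult_1_right)
      then show ?thesis using \<delta> by (simp add: infl)
    qed
    from ln_inverse_influence_le[of n F S "1 / 512" \<delta>, OF F(1) mean_F S dev _ \<delta> this]
    have "(1 / 512)\<^sup>2 / 16 * ln (1 / \<delta>) \<le> 3 * (192 * (K + 1))" using HS by linarith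
    moreover have "ln (1 / \<delta>) = 1000 * 2 ^ 22 * (K + 1)\<^sup>2 * ln 2"
      by (simp add: \<delta>_def ln_div ln_powr)
    ultimately have "1000 * ((K + 1)\<^sup>2 * ln 2) \<le> 576 * (K + 1)"
      by (simp add: power_divide mult_ac)
    \<comment> \<open>The argument gives an exponent linear in K + 1; as K \<ge> 0, the square
      dominates it.\<close>
    moreover have "(K + 1) * (2 / 3) \<le> (K + 1)\<^sup>2 * ln 2"
      using K ln2_ge_two_thirds by (intro mult_mono) (auto simp: power2_eq_square)
    ultimately have "1000 * ((K + 1) * (2 / 3)) \<le> 576 * (K + 1)"
      by (elim order_trans[rotated]) (intro mult_left_mono; simp)
    then show False using K by simp
  qed
qed simp

end
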